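(* Let $(\mathcal{A},[\cdot,\cdot]_{\mathcal{A}},a_{\mathcal{A}};\rho)$ be a LieRep pair, with $\rho$ a representation on $E$. Then the map $\Phi:\mathcal{C}^k(E,\mathcal{A})\to\mathrm{Der}^k(E)$, $k\ge0$, given by $$\Phi(P)(u_1,\dots,u_k,u_{k+1})=\rho(P(u_1,\dots,u_k))u_{k+1},\qquad u_1,\dots,u_{k+1}\in\Gamma(E),$$ is a homomorphism of graded Lie algebras from $(\mathcal{C}^*(E,\mathcal{A}),[\![\cdot,\cdot]\!])$ to $(\mathrm{Der}^*(E),[\cdot,\cdot]_{\mathrm{MN}})$.
   Context: Vector bundles are smooth real vector bundles over a smooth manifold $M$. A Lie algebroid $(\mathcal{A},[\cdot,\cdot]_{\mathcal{A}},a_{\mathcal{A}})$ is a vector bundle $\mathcal{A}\to M$ with a Lie bracket on $\Gamma(\mathcal{A})$ and a bundle map $a_{\mathcal{A}}:\mathcal{A}\to TM$ with $[x,fy]_{\mathcal{A}}=f[x,y]_{\mathcal{A}}+a_{\mathcal{A}}(x)(f)y$. A representation of $\mathcal{A}$ on $E$ is a $C^\infty(M)$-linear map $x\mapsto\rho(x)$ from $\Gamma(\mathcal{A})$ to $\mathbb{R}$-linear operators on $\Gamma(E)$ with $\rho(x)(fu)=f\rho(x)u+a_{\mathcal{A}}(x)(f)u$ and $\rho([x,y]_{\mathcal{A}})=\rho(x)\rho(y)-\rho(y)\rho(x)$. A LieRep pair $(\mathcal{A};\rho)$ is a Lie algebroid with a representation $\rho$ on a vector bundle $E$. $\mathbb{S}_{(i_1,\dots,i_k)}$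 is the set of unshuffles (permutations increasing on consecutive blocks of lengths $i_1,\dots,i_k$), $(-1)^\sigma$ is the sign, and a sum involving a block of length $-1$ is zero. $\mathcal{C}^k(E,\mathcal{A})=\Gamma(\mathrm{Hom}(\wedge^kE,\mathcal{A}))$ (degree $k$), $\mathcal{C}^*(E,\mathcal{A})=\oplus_{k\ge0}\mathcal{C}^k(E,\mathcal{A})$, with graded Lie bracket, for $P\in \mathcal{C}^n(E,\mathcal{A})$, $Q\in \mathcal{C}^m(E,\mathcal{A})$, $$\begin{aligned} [\![P,Q]\!](u_1,\dots,u_{m+n})={}&\sum_{\sigma\in\mathbb{S}_{(m,1,n-1)}} (-1)^\sigma P(\rho(Q(u_{\sigma(1)},\dots,u_{\sigma(m)}))u_{\sigma(m+1)},u_{\sigma(m+2)},\dots,u_{\sigma(m+n)})\\ &-(-1)^{mn}\sum_{\sigma\in\mathbb{S}_{(n,1,m-1)}} (-1)^\sigma Q(\rho(P(u_{\sigma(1)},\dots,u_{\sigma(n)}))u_{\sigma(n+1)},u_{\sigma(n+2)},\dots,u_{\sigma(m+n)})\\ &+(-1)^{mn}\sum_{\sigma\in\mathbb{S}_{(n,m)}} (-1)^\sigma [P(u_{\sigma(1)},\dots,u_{\sigma(n)}),Q(u_{\sigma(n+1)},\dots,u_{\sigma(m+n)})]_{\mathcal{A}}. \end{aligned}$$ $\mathrm{Der}^n(E)$, $n\ge0$, is the space of $\mathbb{R}$-multilinear maps $D\in\mathrm{Hom}(\wedge^n\Gamma(E)\otimes\Gamma(E),\Gamma(E))$ that are $C^\infty(M)$-linear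 in each of the first $n$ arguments and satisfy $D(u_1,\dots,u_n,fu_{n+1})=fD(u_1,\dots,u_{n+1})+\sigma_D(u_1,\dots,u_n)(f)u_{n+1}$ for some $\sigma_D\in\Gamma(\mathrm{Hom}(\wedge^nE,TM))$. $\mathrm{Der}^*(E)=\oplus_{n\ge0}\mathrm{Der}^n(E)$ (with $\mathrm{Der}^n$ in degree $n$) has the graded Lie bracket, for $D_1\in\mathrm{Der}^n(E)$, $D_2\in\mathrm{Der}^m(E)$, $[D_1,D_2]_{\mathrm{MN}}=D_1\circ D_2-(-1)^{mn}D_2\circ D_1$ with $$\begin{aligned} (D_1\circ D_2)(u_1,\dots,u_{m+n+1})={}&\sum_{\sigma\in\mathbb{S}_{(m,1,n-1)}}(-1)^\sigma D_1(D_2(u_{\sigma(1)},\dots,u_{\sigma(m+1)}),u_{\sigma(m+2)},\dots,u_{\sigma(m+n)},u_{m+n+1})\\ &+(-1)^{mn}\sum_{\sigma\in\mathbb{S}_{(n,m)}}(-1)^\sigma D_1(u_{\sigma(1)},\dots,u_{\sigma(n)},D_2(u_{\sigma(n+1)},\dots,u_{\sigma(m+n)},u_{m+n+1})). \end{aligned}$$ *)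

theory Defs
  imports
    "HOL-Analysis.Analysis"
    "HOL-Library.Function_Algebras"
    "HOL-Combinatorics.Permutations"
begin

section \<open>Preliminaries\<close>

text \<open>Pointwise real vector space structure on functions. It is used for sections, for
  operators on tuples of sections and for families of operators alike.\<close>

instantiation "fun" :: (type, real_vector) real_vector
begin

definition scaleR_fun_def: "c *\<^sub>R f = (\<lambda>x. c *\<^sub>R f x)"

instance
  by standard (simp_all add: scaleR_fun_def fun_eq_iff algebra_simps)

end

text \<open>Model spaces \<open>\<real>\<^sup>n\<close> with \<open>n \<ge> 0\<close>. The class \<^class>\<open>euclidean_space\<close> has the same axioms except
  that its basis must be non-empty, which would exclude bundles of rank 0 and manifolds of
  dimension 0.\<close>

class fin_dim = real_inner +
  assumes orthonormal_basis_exists: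
    "\<exists>B. finite B \<and> (\<forall>u\<in>B. \<forall>v\<in>B. inner u v = (if u = v then 1 else 0)) \<and>
       (\<forall>x. (\<forall>u\<in>B. inner x u = 0) \<longleftrightarrow> x = 0)"

subclass (in euclidean_space) fin_dim
  by standard
    (rule exI[of _ Basis], simp add: finite_Basis inner_Basis euclidean_all_zero_iff)

primrec C_k_on :: "nat \<Rightarrow> 'b::real_normed_vector set \<Rightarrow> ('b \<Rightarrow> 'c::real_normed_vector) \<Rightarrow> bool" where
  "C_k_on 0 S f \<longleftrightarrow> continuous_on S f"
| "C_k_on (Suc k) S f \<longleftrightarrow> (\<forall>x\<in>S. f differentiable (at x)) \<and>
     (\<forall>v. C_k_on k S (\<lambda>x. frechet_derivative f (at x) v))"

text \<open>Only meant for open subsets \<open>S\<close> of a finite-dimensional space.\<close>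

definition smooth_on :: "'b::real_normed_vector set \<Rightarrow> ('b \<Rightarrow> 'c::real_normed_vector) \<Rightarrow> bool" where
  "smooth_on S f \<longleftrightarrow> (\<forall>k. C_k_on k S f)"

definition tuples :: "'x set \<Rightarrow> nat \<Rightarrow> 'x list set" where
  "tuples S k = {us. length us = k \<and> set us \<subseteq> S}"

text \<open>\<open>F\<close> is \<open>\<real>\<close>-multilinear on \<open>k\<close>-tuples of elements of the linear subspace \<open>S\<close>.\<close>

definition multilinear_on :: "'x::real_vector set \<Rightarrow> nat \<Rightarrow> ('x list \<Rightarrow> 'y::real_vector) \<Rightarrow> bool" where
  "multilinear_on S k F \<longleftrightarrow>
     (\<forall>us\<in>tuples S k. \<forall>i<k. \<forall>u\<in>S. \<forall>v\<in>S. \<forall>c.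
        F (us[i := u + v]) = F (us[i := u]) + F (us[i := v]) \<and>
        F (us[i := c *\<^sub>R u]) = c *\<^sub>R F (us[i := u]))"

text \<open>\<open>F\<close>, a function of \<open>k\<close>-tuples, is alternating in its first \<open>l\<close> arguments.\<close>

definition alternating_on :: "'x set \<Rightarrow> nat \<Rightarrow> nat \<Rightarrow> ('x list \<Rightarrow> 'y::zero) \<Rightarrow> bool" where
  "alternating_on S l k F \<longleftrightarrow>
     (\<forall>us\<in>tuples S k. \<forall>i j. i < j \<and> j < l \<and> us ! i = us ! j \<longrightarrow> F us = 0)"

section \<open>Smooth manifolds and vector bundles\<close>

text \<open>A manifold is a Hausdorff, second countable type together with a smooth atlas; a chart is
  a pair of its open domain and its coordinate map.\<close>

type_synonym ('m, 'b) chart = "'m set \<times> ('m \<Rightarrow> 'b)"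

definition mfd_smooth_on ::
  "('m, 'b::fin_dim) chart set \<Rightarrow> 'm set \<Rightarrow> ('m \<Rightarrow> 'c::real_normed_vector) \<Rightarrow> bool" where
  "mfd_smooth_on atlas S f \<longleftrightarrow>
     (\<forall>(U, \<phi>)\<in>atlas. smooth_on (\<phi> ` (S \<inter> U)) (f \<circ> inv_into U \<phi>))"

locale smooth_manifold =
  fixes atlas :: "('m::{t2_space, second_countable_topology}, 'b::fin_dim) chart set"
  assumes open_domain: "(U, \<phi>) \<in> atlas \<Longrightarrow> open U"
    and open_image: "(U, \<phi>) \<in> atlas \<Longrightarrow> open (\<phi> ` U)"
    and chart_homeomorphism: "(U, \<phi>) \<in> atlas \<Longrightarrow> homeomorphism U (\<phi> ` U) \<phi> (inv_into U \<phi>)"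
    and charts_cover: "(\<Union>(U, \<phi>)\<in>atlas. U) = UNIV"
    and smooth_transition:
      "(U, \<phi>) \<in> atlas \<Longrightarrow> (V, \<psi>) \<in> atlas \<Longrightarrow> smooth_on (\<phi> ` (U \<inter> V)) (\<psi> \<circ> inv_into U \<phi>)"

definition smooth_functions :: "('m, 'b::fin_dim) chart set \<Rightarrow> ('m \<Rightarrow> real) set" where
  "smooth_functions atlas = {f. mfd_smooth_on atlas UNIV f}"

text \<open>The fibres of a bundle are subspaces of one ambient vector space \<open>'e\<close>, e.g. of the direct
  sum of all fibres. A local trivialization \<open>(U, \<tau>)\<close> consists of an open set \<open>U\<close> and
  isomorphisms \<open>\<tau> x\<close> from the fibre over \<open>x \<in> U\<close> to the model fibre \<open>'f\<close>. The smooth structure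
  (and topology) of the total space is the one determined by the trivializations.\<close>

record ('m, 'e, 'f) vbundle =
  fibre :: "'m \<Rightarrow> 'e set"
  trivs :: "('m set \<times> ('m \<Rightarrow> 'e \<Rightarrow> 'f)) set"

locale vector_bundle = smooth_manifold atlas
  for atlas :: "('m::{t2_space, second_countable_topology}, 'b::fin_dim) chart set" +
  fixes E :: "('m, 'e::real_vector, 'f::fin_dim) vbundle"
  assumes subspace_fibre: "subspace (fibre E x)"
    and triv_open: "(U, \<tau>) \<in> trivs E \<Longrightarrow> open U"
    and trivs_cover: "(\<Union>(U, \<tau>)\<in>trivs E. U) = UNIV"
    and triv_bij: "(U, \<tau>) \<in> trivs E \<Longrightarrow> x \<in> U \<Longrightarrow> bij_betw (\<tau> x) (fibre E x) UNIV"
    and triv_add: "(U, \<tau>) \<in> trivs E \<Longrightarrow> x \<in> U \<Longrightarrow> v \<in> fibre E x \<Longrightarrow> w \<in> fibre E x \<Longrightarrow>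
      \<tau> x (v + w) = \<tau> x v + \<tau> x w"
    and triv_scale: "(U, \<tau>) \<in> trivs E \<Longrightarrow> x \<in> U \<Longrightarrow> v \<in> fibre E x \<Longrightarrow> \<tau> x (c *\<^sub>R v) = c *\<^sub>R \<tau> x v"
    and triv_transition: "(U, \<tau>) \<in> trivs E \<Longrightarrow> (V, \<kappa>) \<in> trivs E \<Longrightarrow>
      mfd_smooth_on atlas (U \<inter> V) (\<lambda>x. \<kappa> x (inv_into (fibre E x) (\<tau> x) z))"

text \<open>\<open>\<Gamma>(E)\<close>\<close>

definition sections ::
  "('m, 'b::fin_dim) chart set \<Rightarrow> ('m, 'e::real_vector, 'f::fin_dim) vbundle \<Rightarrow> ('m \<Rightarrow> 'e) set" where
  "sections atlas E = {s. (\<forall>x. s x \<in> fibre E x) \<and>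
     (\<forall>(U, \<tau>)\<in>trivs E. mfd_smooth_on atlas U (\<lambda>x. \<tau> x (s x)))}"

text \<open>\<open>\<Gamma>(Hom(\<And>\<^sup>k E, F))\<close>: families of alternating \<open>k\<close>-linear maps between fibres whose components
  in local trivializations are smooth. Values off \<open>k\<close>-tuples of fibre elements are irrelevant.\<close>

definition hom_sections ::
  "('m, 'b::fin_dim) chart set \<Rightarrow> ('m, 'e::real_vector, 'f::fin_dim) vbundle \<Rightarrow>
   ('m, 'a::real_vector, 'g::fin_dim) vbundle \<Rightarrow> nat \<Rightarrow> ('m \<Rightarrow> 'e list \<Rightarrow> 'a) set" where
  "hom_sections atlas E F k = {P.
     (\<forall>x. (\<forall>vs\<in>tuples (fibre E x) k. P x vs \<in> fibre F x) \<and>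
          multilinear_on (fibre E x) k (P x) \<and> alternating_on (fibre E x) k k (P x)) \<and>
     (\<forall>(U, \<tau>)\<in>trivs E. \<forall>(V, \<kappa>)\<in>trivs F. \<forall>zs. length zs = k \<longrightarrow>
        mfd_smooth_on atlas (U \<inter> V)
          (\<lambda>x. \<kappa> x (P x (map (\<lambda>z. inv_into (fibre E x) (\<tau> x) z) zs))))}"

text \<open>A tangent vector at \<open>x\<close> assigns to every chart around \<open>x\<close> its component vector, subject to
  the usual transformation rule. It is set to 0 on all other arguments, so that it is determined
  by its components.\<close>

definition tangent_space ::
  "('m, 'b::fin_dim) chart set \<Rightarrow> 'm \<Rightarrow> (('m, 'b) chart \<Rightarrow> 'b) set" where
  "tangent_space atlas x = {v.
     (\<forall>c. c \<notin> atlas \<or> x \<notin> fst c \<longrightarrow> v c = 0) \<and>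
     (\<forall>(U, \<phi>)\<in>atlas. \<forall>(V, \<psi>)\<in>atlas. x \<in> U \<inter> V \<longrightarrow>
        v (V, \<psi>) = frechet_derivative (\<psi> \<circ> inv_into U \<phi>) (at (\<phi> x)) (v (U, \<phi>)))}"

definition tangent_bundle ::
  "('m, 'b::fin_dim) chart set \<Rightarrow> ('m, ('m, 'b) chart \<Rightarrow> 'b, 'b) vbundle" where
  "tangent_bundle atlas =
     \<lparr>fibre = tangent_space atlas, trivs = {(U, \<lambda>x v. v (U, \<phi>)) |U \<phi>. (U, \<phi>) \<in> atlas}\<rparr>"

text \<open>The derivative \<open>v(f)\<close> of \<open>f\<close> along the tangent vector \<open>v\<close> at \<open>x\<close>; by the transformation rule
  it does not depend on the chart.\<close>

definition tangent_act ::
  "('m, 'b::fin_dim) chart set \<Rightarrow> 'm \<Rightarrow> (('m, 'b) chart \<Rightarrow> 'b) \<Rightarrow> ('m \<Rightarrow> real) \<Rightarrow> real" where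
  "tangent_act atlas x v f =
     (let c = SOME c. c \<in> atlas \<and> x \<in> fst c
      in frechet_derivative (f \<circ> inv_into (fst c) (snd c)) (at (snd c x)) (v c))"

definition fun_mult :: "('m \<Rightarrow> real) \<Rightarrow> ('m \<Rightarrow> 'e::real_vector) \<Rightarrow> ('m \<Rightarrow> 'e)" (infixr "\<cdot>" 75) where
  "f \<cdot> u = (\<lambda>x. f x *\<^sub>R u x)"

section \<open>LieRep pairs\<close>

locale lie_algebroid = vector_bundle atlas A
  for atlas :: "('m::{t2_space, second_countable_topology}, 'b::fin_dim) chart set"
    and A :: "('m, 'a::real_vector, 'g::fin_dim) vbundle" +
  fixes brk :: "('m \<Rightarrow> 'a) \<Rightarrow> ('m \<Rightarrow> 'a) \<Rightarrow> ('m \<Rightarrow> 'a)"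
    and anchor :: "'m \<Rightarrow> 'a \<Rightarrow> (('m, 'b) chart \<Rightarrow> 'b)"
  assumes brk_closed: "x \<in> sections atlas A \<Longrightarrow> y \<in> sections atlas A \<Longrightarrow> brk x y \<in> sections atlas A"
    and brk_add_left: "x \<in> sections atlas A \<Longrightarrow> y \<in> sections atlas A \<Longrightarrow> z \<in> sections atlas A \<Longrightarrow>
      brk (x + y) z = brk x z + brk y z"
    and brk_scale_left: "x \<in> sections atlas A \<Longrightarrow> y \<in> sections atlas A \<Longrightarrow>
      brk (c *\<^sub>R x) y = c *\<^sub>R brk x y"
    and brk_skew: "x \<in> sections atlas A \<Longrightarrow> y \<in> sections atlas A \<Longrightarrow> brk x y = - brk y x"
    and brk_jacobi: "x \<in> sections atlas A \<Longrightarrow> y \<in> sections atlas A \<Longrightarrow> z \<in> sections atlas A \<Longrightarrow>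
      brk x (brk y z) + brk y (brk z x) + brk z (brk x y) = 0"
    \<comment> \<open>a bundle map is a section of \<open>Hom(A, TM)\<close>\<close>
    and anchor_bundle_map:
      "(\<lambda>p vs. anchor p (hd vs)) \<in> hom_sections atlas A (tangent_bundle atlas) 1"
    and brk_leibniz: "x \<in> sections atlas A \<Longrightarrow> y \<in> sections atlas A \<Longrightarrow> f \<in> smooth_functions atlas \<Longrightarrow>
      brk x (f \<cdot> y) = f \<cdot> brk x y + (\<lambda>p. tangent_act atlas p (anchor p (x p)) f) \<cdot> y"

locale lie_rep_pair =
  lie_algebroid atlas A brk anchor + E: vector_bundle atlas E
  for atlas :: "('m::{t2_space, second_countable_topology}, 'b::fin_dim) chart set"
    and A :: "('m, 'a::real_vector, 'g::fin_dim) vbundle"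
    and brk :: "('m \<Rightarrow> 'a) \<Rightarrow> ('m \<Rightarrow> 'a) \<Rightarrow> ('m \<Rightarrow> 'a)"
    and anchor :: "'m \<Rightarrow> 'a \<Rightarrow> (('m, 'b) chart \<Rightarrow> 'b)"
    and E :: "('m, 'e::real_vector, 'f::fin_dim) vbundle" +
  fixes \<rho> :: "('m \<Rightarrow> 'a) \<Rightarrow> ('m \<Rightarrow> 'e) \<Rightarrow> ('m \<Rightarrow> 'e)"
  assumes rep_closed: "x \<in> sections atlas A \<Longrightarrow> u \<in> sections atlas E \<Longrightarrow> \<rho> x u \<in> sections atlas E"
    and rep_add: "x \<in> sections atlas A \<Longrightarrow> u \<in> sections atlas E \<Longrightarrow> v \<in> sections atlas E \<Longrightarrow>
      \<rho> x (u + v) = \<rho> x u + \<rho> x v"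
    and rep_scale: "x \<in> sections atlas A \<Longrightarrow> u \<in> sections atlas E \<Longrightarrow> \<rho> x (c *\<^sub>R u) = c *\<^sub>R \<rho> x u"
    and rep_add_left: "x \<in> sections atlas A \<Longrightarrow> y \<in> sections atlas A \<Longrightarrow> u \<in> sections atlas E \<Longrightarrow>
      \<rho> (x + y) u = \<rho> x u + \<rho> y u"
    and rep_fun_left: "x \<in> sections atlas A \<Longrightarrow> u \<in> sections atlas E \<Longrightarrow> f \<in> smooth_functions atlas \<Longrightarrow>
      \<rho> (f \<cdot> x) u = f \<cdot> \<rho> x u"
    and rep_leibniz: "x \<in> sections atlas A \<Longrightarrow> u \<in> sections atlas E \<Longrightarrow> f \<in> smooth_functions atlas \<Longrightarrow>
      \<rho> x (f \<cdot> u) = f \<cdot> \<rho> x u + (\<lambda>p. tangent_act atlas p (anchor p (x p)) f) \<cdot> u"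
    and rep_bracket: "x \<in> sections atlas A \<Longrightarrow> y \<in> sections atlas A \<Longrightarrow> u \<in> sections atlas E \<Longrightarrow>
      \<rho> (brk x y) u = \<rho> x (\<rho> y u) - \<rho> y (\<rho> x u)"

section \<open>Unshuffles\<close>

text \<open>Permutations of \<open>{..<N}\<close>, where \<open>N\<close> is the sum of the block lengths; the \<open>i\<close>-th argument
  (counted from 1) of the mathematical notation is entry \<open>i - 1\<close> of a list. Block lengths are
  integers: there are no unshuffles with a block of negative length, so that a sum over them is 0.\<close>

definition unshuffles :: "int list \<Rightarrow> (nat \<Rightarrow> nat) set" where
  "unshuffles bs = (if \<exists>b\<in>set bs. b < 0 then {}
     else {\<sigma>. \<sigma> permutes {..<nat (sum_list bs)} \<and>
       (\<forall>j<length bs. strict_mono_on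
          {nat (sum_list (take j bs))..<nat (sum_list (take (Suc j) bs))} \<sigma>)})"

text \<open>The sublist \<open>u\<^bsub>\<sigma>(i)\<^esub>, \<dots>, u\<^bsub>\<sigma>(j-1)\<^esub>\<close>\<close>

definition subargs :: "'x list \<Rightarrow> (nat \<Rightarrow> nat) \<Rightarrow> nat \<Rightarrow> nat \<Rightarrow> 'x list" where
  "subargs us \<sigma> i j = map (\<lambda>l. us ! \<sigma> l) [i..<j]"

abbreviation sgn_perm :: "(nat \<Rightarrow> nat) \<Rightarrow> real" where
  "sgn_perm \<sigma> \<equiv> real_of_int (sign \<sigma>)"

section \<open>The graded spaces and brackets\<close>

text \<open>\<open>\<C>\<^sup>k(E, A)\<close>: sections of \<open>Hom(\<And>\<^sup>k E, A)\<close>, regarded as operators from \<open>k\<close>-tuples in \<open>\<Gamma>(E)\<close>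
  to \<open>\<Gamma>(A)\<close>. All operators on tuples of sections are extended by 0 to other lists, so that equality
  of operators is equality on tuples of sections of the right length.\<close>

definition cochains ::
  "('m, 'b::fin_dim) chart set \<Rightarrow> ('m, 'e::real_vector, 'f::fin_dim) vbundle \<Rightarrow>
   ('m, 'a::real_vector, 'g::fin_dim) vbundle \<Rightarrow> nat \<Rightarrow> (('m \<Rightarrow> 'e) list \<Rightarrow> ('m \<Rightarrow> 'a)) set" where
  "cochains atlas E A k =
     (\<lambda>P us. if us \<in> tuples (sections atlas E) k then (\<lambda>x. P x (map (\<lambda>u. u x) us)) else 0) `
       hom_sections atlas E A k"

definition cochain_bracket ::
  "('m, 'b::fin_dim) chart set \<Rightarrow> ('m, 'e::real_vector, 'f::fin_dim) vbundle \<Rightarrow>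
   (('m \<Rightarrow> 'a::real_vector) \<Rightarrow> ('m \<Rightarrow> 'a) \<Rightarrow> ('m \<Rightarrow> 'a)) \<Rightarrow>
   (('m \<Rightarrow> 'a) \<Rightarrow> ('m \<Rightarrow> 'e) \<Rightarrow> ('m \<Rightarrow> 'e)) \<Rightarrow> nat \<Rightarrow> nat \<Rightarrow>
   (('m \<Rightarrow> 'e) list \<Rightarrow> ('m \<Rightarrow> 'a)) \<Rightarrow> (('m \<Rightarrow> 'e) list \<Rightarrow> ('m \<Rightarrow> 'a)) \<Rightarrow>
   (('m \<Rightarrow> 'e) list \<Rightarrow> ('m \<Rightarrow> 'a))" where
  "cochain_bracket atlas E brk \<rho> n m P Q us =
     (if us \<in> tuples (sections atlas E) (m + n) then
        (\<Sum>\<sigma>\<in>unshuffles [int m, 1, int n - 1]. sgn_perm \<sigma> *\<^sub>R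
           P (\<rho> (Q (subargs us \<sigma> 0 m)) (us ! \<sigma> m) # subargs us \<sigma> (m + 1) (m + n)))
        - (-1) ^ (m * n) *\<^sub>R (\<Sum>\<sigma>\<in>unshuffles [int n, 1, int m - 1]. sgn_perm \<sigma> *\<^sub>R
           Q (\<rho> (P (subargs us \<sigma> 0 n)) (us ! \<sigma> n) # subargs us \<sigma> (n + 1) (m + n)))
        + (-1) ^ (m * n) *\<^sub>R (\<Sum>\<sigma>\<in>unshuffles [int n, int m]. sgn_perm \<sigma> *\<^sub>R
           brk (P (subargs us \<sigma> 0 n)) (Q (subargs us \<sigma> n (m + n))))
      else 0)"

definition ders ::
  "('m, 'b::fin_dim) chart set \<Rightarrow> ('m, 'e::real_vector, 'f::fin_dim) vbundle \<Rightarrow>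
   nat \<Rightarrow> (('m \<Rightarrow> 'e) list \<Rightarrow> ('m \<Rightarrow> 'e)) set" where
  "ders atlas E n = {D.
     (\<forall>us. us \<notin> tuples (sections atlas E) (n + 1) \<longrightarrow> D us = 0) \<and>
     (\<forall>us\<in>tuples (sections atlas E) (n + 1). D us \<in> sections atlas E) \<and>
     multilinear_on (sections atlas E) (n + 1) D \<and>
     alternating_on (sections atlas E) n (n + 1) D \<and>
     (\<forall>us\<in>tuples (sections atlas E) (n + 1). \<forall>i<n. \<forall>u\<in>sections atlas E.
        \<forall>f\<in>smooth_functions atlas. D (us[i := f \<cdot> u]) = f \<cdot> D (us[i := u])) \<and>
     (\<exists>symb\<in>hom_sections atlas E (tangent_bundle atlas) n.
        \<forall>us\<in>tuples (sections atlas E) n. \<forall>u\<in>sections atlas E. \<forall>f\<in>smooth_functions atlas.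
          D (us @ [f \<cdot> u]) = f \<cdot> D (us @ [u]) +
            (\<lambda>x. tangent_act atlas x (symb x (map (\<lambda>w. w x) us)) f) \<cdot> u)}"

definition der_comp ::
  "('m, 'b::fin_dim) chart set \<Rightarrow> ('m, 'e::real_vector, 'f::fin_dim) vbundle \<Rightarrow> nat \<Rightarrow> nat \<Rightarrow>
   (('m \<Rightarrow> 'e) list \<Rightarrow> ('m \<Rightarrow> 'e)) \<Rightarrow> (('m \<Rightarrow> 'e) list \<Rightarrow> ('m \<Rightarrow> 'e)) \<Rightarrow>
   (('m \<Rightarrow> 'e) list \<Rightarrow> ('m \<Rightarrow> 'e))" where
  "der_comp atlas E n m D1 D2 us =
     (if us \<in> tuples (sections atlas E) (m + n + 1) then
        (\<Sum>\<sigma>\<in>unshuffles [int m, 1, int n - 1]. sgn_perm \<sigma> *\<^sub>R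
           D1 (D2 (subargs us \<sigma> 0 (m + 1)) # subargs us \<sigma> (m + 1) (m + n) @ [us ! (m + n)]))
        + (-1) ^ (m * n) *\<^sub>R (\<Sum>\<sigma>\<in>unshuffles [int n, int m]. sgn_perm \<sigma> *\<^sub>R
           D1 (subargs us \<sigma> 0 n @ [D2 (subargs us \<sigma> n (m + n) @ [us ! (m + n)])]))
      else 0)"

definition mn_bracket ::
  "('m, 'b::fin_dim) chart set \<Rightarrow> ('m, 'e::real_vector, 'f::fin_dim) vbundle \<Rightarrow> nat \<Rightarrow> nat \<Rightarrow>
   (('m \<Rightarrow> 'e) list \<Rightarrow> ('m \<Rightarrow> 'e)) \<Rightarrow> (('m \<Rightarrow> 'e) list \<Rightarrow> ('m \<Rightarrow> 'e)) \<Rightarrow>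
   (('m \<Rightarrow> 'e) list \<Rightarrow> ('m \<Rightarrow> 'e))" where
  "mn_bracket atlas E n m D1 D2 =
     der_comp atlas E n m D1 D2 - (-1) ^ (m * n) *\<^sub>R der_comp atlas E m n D2 D1"

definition Phi ::
  "('m, 'b::fin_dim) chart set \<Rightarrow> ('m, 'e::real_vector, 'f::fin_dim) vbundle \<Rightarrow>
   (('m \<Rightarrow> 'a::real_vector) \<Rightarrow> ('m \<Rightarrow> 'e) \<Rightarrow> ('m \<Rightarrow> 'e)) \<Rightarrow> nat \<Rightarrow>
   (('m \<Rightarrow> 'e) list \<Rightarrow> ('m \<Rightarrow> 'a)) \<Rightarrow> (('m \<Rightarrow> 'e) list \<Rightarrow> ('m \<Rightarrow> 'e))" where
  "Phi atlas E \<rho> k P us =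
     (if us \<in> tuples (sections atlas E) (k + 1) then \<rho> (P (take k us)) (us ! k) else 0)"

section \<open>Homomorphisms of graded Lie algebras\<close>

text \<open>Elements of \<open>\<Oplus>\<^bsub>k\<^esub> V k\<close> are families with finitely many non-zero components. A graded bracket is
  given on homogeneous elements (\<open>br n m\<close> on \<open>V n \<times> V m\<close>, of degree \<open>n + m\<close>) and extended
  bilinearly.\<close>

definition direct_sum :: "(nat \<Rightarrow> 'x::real_vector set) \<Rightarrow> (nat \<Rightarrow> 'x) set" where
  "direct_sum V = {F. (\<forall>k. F k \<in> V k) \<and> finite {k. F k \<noteq> 0}}"

definition total_bracket ::
  "(nat \<Rightarrow> nat \<Rightarrow> 'x \<Rightarrow> 'x \<Rightarrow> 'x::real_vector) \<Rightarrow> (nat \<Rightarrow> 'x) \<Rightarrow> (nat \<Rightarrow> 'x) \<Rightarrow> (nat \<Rightarrow> 'x)" where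
  "total_bracket br F G = (\<lambda>k. \<Sum>n\<le>k. br n (k - n) (F n) (G (k - n)))"

text \<open>\<open>\<real>\<close>-linear, degree-preserving and compatible with the brackets. That the brackets satisfy the
  axioms of a graded Lie algebra is a property of source and target, not of the map.\<close>

definition graded_lie_hom ::
  "(nat \<Rightarrow> 'x::real_vector set) \<Rightarrow> (nat \<Rightarrow> nat \<Rightarrow> 'x \<Rightarrow> 'x \<Rightarrow> 'x) \<Rightarrow>
   (nat \<Rightarrow> 'y::real_vector set) \<Rightarrow> (nat \<Rightarrow> nat \<Rightarrow> 'y \<Rightarrow> 'y \<Rightarrow> 'y) \<Rightarrow>
   ((nat \<Rightarrow> 'x) \<Rightarrow> (nat \<Rightarrow> 'y)) \<Rightarrow> bool" where
  "graded_lie_hom V brV W brW \<Psi> \<longleftrightarrow>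
     (\<forall>F\<in>direct_sum V. \<Psi> F \<in> direct_sum W) \<and>
     (\<forall>F\<in>direct_sum V. \<forall>G\<in>direct_sum V. \<Psi> (F + G) = \<Psi> F + \<Psi> G) \<and>
     (\<forall>F\<in>direct_sum V. \<forall>c. \<Psi> (c *\<^sub>R F) = c *\<^sub>R \<Psi> F) \<and>
     (\<forall>F\<in>direct_sum V. \<forall>k. (\<forall>j. j \<noteq> k \<longrightarrow> F j = 0) \<longrightarrow> (\<forall>j. j \<noteq> k \<longrightarrow> \<Psi> F j = 0)) \<and>
     (\<forall>F\<in>direct_sum V. \<forall>G\<in>direct_sum V.
        \<Psi> (total_bracket brV F G) = total_bracket brW (\<Psi> F) (\<Psi> G))"

end

theory Submission
  imports Defs
begin

text \<open>Substituting \<open>\<Phi>\<close> into the bracket of derivations produces the two insertion sums of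
  \<open>[[P, Q]]\<close> verbatim, together with the sum of the \<open>\<rho>(P) \<rho>(Q)\<close> over \<open>(n,m)\<close>-unshuffles and the sum of
  the \<open>\<rho>(Q) \<rho>(P)\<close> over \<open>(m,n)\<close>-unshuffles. Exchanging the two blocks of an unshuffle contributes
  the sign \<open>(-1)\<close> to the power \<open>mn\<close>, and \<open>\<rho>([x, y]) = [\<rho>(x), \<rho>(y)]\<close> identifies the difference of
  these sums with the remaining term of \<open>[[P, Q]]\<close>. The symbol of \<open>\<Phi>(P)\<close> is \<open>a \<circ> P\<close>. Smoothness of
  \<open>P(u\<^sub>1, \<dots>, u\<^sub>k)\<close> and of \<open>a \<circ> P\<close> is checked locally, by expanding the arguments one after the
  other in a local frame.\<close>

section \<open>Signs of unshuffles\<close>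

text \<open>The cycle n \<mapsto> n + 1 \<mapsto> ... \<mapsto> n + m \<mapsto> n of length m + 1.
  It moves a block of m consecutive values up by one place and lets the value above it drop below
  the block.\<close>

definition cycle_up :: "nat \<Rightarrow> nat \<Rightarrow> nat \<Rightarrow> nat" where
  "cycle_up n m i = (if n \<le> i \<and> i < n + m then Suc i else if i = n + m then n else i)"

text \<open>Lengthening the cycle by one entry is composition with one transposition, so each step
  changes the sign.\<close>

lemma cycle_up_sign: "cycle_up n m permutes {..n + m} \<and> sign (cycle_up n m) = (-1) ^ m"
proof (induction m)
  case 0
  have "cycle_up n 0 = id" by (auto simp: cycle_up_def)
  then show ?case by (simp add: permutes_def)
next
  case (Suc m)
  have eq: "cycle_up n (Suc m) = Transposition.transpose n (n + Suc m) \<circ> cycle_up n m"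
    by (auto simp: cycle_up_def Transposition.transpose_def fun_eq_iff)
  have "cycle_up n m permutes {..n + Suc m}"
    using Suc by (auto intro: permutes_subset)
  moreover have "Transposition.transpose n (n + Suc m) permutes {..n + Suc m}"
    by (rule permutes_swap_id) auto
  ultimately have "cycle_up n (Suc m) permutes {..n + Suc m}"
    unfolding eq by (rule permutes_compose)
  moreover have "permutation (cycle_up n m)"
    using Suc by (auto intro: permutes_imp_permutation)
  then have "sign (cycle_up n (Suc m)) = sign (Transposition.transpose n (n + Suc m)) * sign (cycle_up n m)"
    unfolding eq by (intro sign_compose permutation_swap_id)
  ultimately show ?case
    using Suc by (simp add: sign_swap_id)
qed

text \<open>The exchange of a block of length \<open>m\<close> with the following block of length \<open>n\<close>, built up by
  \<open>n\<close> cycles of length \<open>m + 1\<close>.\<close>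

definition block_swap :: "nat \<Rightarrow> nat \<Rightarrow> nat \<Rightarrow> nat" where
  "block_swap m n i = (if i < m then i + n else if i < m + n then i - m else i)"

lemma block_swap_sign:
  "block_swap m n permutes {..<m + n} \<and> sign (block_swap m n) = (-1) ^ (m * n)"
proof (induction n)
  case 0
  have "block_swap m 0 = id" by (auto simp: block_swap_def)
  then show ?case by (simp add: permutes_def)
next
  case (Suc n)
  \<comment> \<open>\<open>block_swap m n\<close> already sends the first block to n, ..., n + m -
    1. The cycle moves it up once more and lets the next entry, still at n + m, drop to n. Each such
    step contributes \<open>(-1) ^ m\<close>.\<close>
  have eq: "block_swap m (Suc n) = cycle_up n m \<circ> block_swap m n"
    by (auto simp: cycle_up_def block_swap_def fun_eq_iff)
  have "block_swap m n permutes {..<m + Suc n}"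
    using Suc by (auto intro: permutes_subset)
  moreover have "cycle_up n m permutes {..<m + Suc n}"
    using cycle_up_sign[of n m] by (simp add: lessThan_Suc_atMost add.commute)
  ultimately have "block_swap m (Suc n) permutes {..<m + Suc n}"
    unfolding eq by (rule permutes_compose)
  moreover have "permutation (cycle_up n m)" "permutation (block_swap m n)"
    using Suc cycle_up_sign[of n m] by (auto intro: permutes_imp_permutation)
  then have "sign (block_swap m (Suc n)) = sign (cycle_up n m) * sign (block_swap m n)"
    unfolding eq by (rule sign_compose)
  ultimately show ?case
    using Suc cycle_up_sign[of n m] by (simp add: power_add)
qed

lemma block_swap_block_swap: "block_swap m n \<circ> block_swap n m = id"
  by (auto simp: block_swap_def fun_eq_iff)

lemma unshuffles_permutes: "\<sigma> \<in> unshuffles bs \<Longrightarrow> \<sigma> permutes {..<nat (sum_list bs)}"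
  by (auto simp: unshuffles_def split: if_splits)

lemma unshuffles_two_iff:
  "\<sigma> \<in> unshuffles [int n, int m] \<longleftrightarrow> \<sigma> permutes {..<n + m} \<and>
    strict_mono_on {0..<n} \<sigma> \<and> strict_mono_on {n..<n + m} \<sigma>"
proof -
  have "nat (int n + int m) = n + m" by simp
  then show ?thesis
    by (simp add: unshuffles_def numeral_2_eq_2 less_Suc_eq all_conj_distrib imp_disjL)
qed

text \<open>Composition on the right permutes positions: on each block of the new permutation,
  \<open>\<sigma>\<close> is evaluated along the other old block, shifted, so monotonicity carries
  over.\<close>

lemma block_swap_unshuffles:
  assumes "\<sigma> \<in> unshuffles [int n, int m]"
  shows "\<sigma> \<circ> block_swap m n \<in> unshuffles [int m, int n]"
proof -
  have \<sigma>: "\<sigma> permutes {..<m + n}" "strict_mono_on {0..<n} \<sigma>" "strict_mono_on {n..<n + m} \<sigma>"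
    using assms by (simp_all add: unshuffles_two_iff add.commute)
  have "strict_mono_on {0..<m} (\<sigma> \<circ> block_swap m n)"
    by (rule strict_mono_onI) (simp add: block_swap_def strict_mono_onD[OF \<sigma>(3)])
  moreover have "strict_mono_on {m..<m + n} (\<sigma> \<circ> block_swap m n)"
    by (rule strict_mono_onI)
      (simp add: block_swap_def, rule strict_mono_onD[OF \<sigma>(2)], auto)
  moreover have "(\<sigma> \<circ> block_swap m n) permutes {..<m + n}"
    using \<sigma>(1) block_swap_sign permutes_compose by blast
  ultimately show ?thesis
    by (simp add: unshuffles_two_iff)
qed

lemma subargs_block_swap:
  "subargs us (\<sigma> \<circ> block_swap m n) 0 m = subargs us \<sigma> n (m + n)"
  "subargs us (\<sigma> \<circ> block_swap m n) m (m + n) = subargs us \<sigma> 0 n"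
  by (auto simp: subargs_def block_swap_def add.commute intro!: nth_equalityI)

text \<open>The map \<open>f\<close> is left abstract because it stands for
  \<open>brk (P xs) (Q ys)\<close> as well as for the composites of the operators \<rho>(P xs) and
  \<rho>(Q ys) in either order.\<close>

definition product_sum ::
  "nat \<Rightarrow> nat \<Rightarrow> ('x list \<Rightarrow> 'x list \<Rightarrow> 'y::real_vector) \<Rightarrow> 'x list \<Rightarrow> 'y" where
  "product_sum n m f us = (\<Sum>\<sigma>\<in>unshuffles [int n, int m].
     sgn_perm \<sigma> *\<^sub>R f (subargs us \<sigma> 0 n) (subargs us \<sigma> n (m + n)))"

text \<open>Composition with the block exchange is a bijection between the two sets of unshuffles.
  It interchanges the two sublists and multiplies the sign by \<open>(-1) ^ (m * n)\<close>.\<close>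

lemma product_sum_swap:
  "product_sum m n h us = (-1) ^ (m * n) *\<^sub>R product_sum n m (\<lambda>xs ys. h ys xs) us"
proof -
  have "(\<Sum>\<sigma>\<in>unshuffles [int m, int n]. sgn_perm \<sigma> *\<^sub>R h (subargs us \<sigma> 0 m) (subargs us \<sigma> m (m + n)))
    = (\<Sum>\<sigma>\<in>unshuffles [int n, int m]. (-1) ^ (m * n) *\<^sub>R
      (sgn_perm \<sigma> *\<^sub>R h (subargs us \<sigma> n (m + n)) (subargs us \<sigma> 0 n)))"
  proof (rule sum.reindex_bij_witness[where i = "\<lambda>\<sigma>. \<sigma> \<circ> block_swap m n" and j = "\<lambda>\<sigma>. \<sigma> \<circ> block_swap n m"])
    fix \<sigma> assume \<sigma>: "\<sigma> \<in> unshuffles [int m, int n]"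
    let ?\<tau> = "\<sigma> \<circ> block_swap n m"
    show "?\<tau> \<circ> block_swap m n = \<sigma>"
      by (simp add: comp_assoc block_swap_block_swap)
    show "?\<tau> \<in> unshuffles [int n, int m]"
      using \<sigma> by (rule block_swap_unshuffles)
    have "permutation \<sigma>" "permutation (block_swap n m)"
      using unshuffles_permutes[OF \<sigma>] block_swap_sign
      by (auto intro: permutes_imp_permutation[OF finite_lessThan])
    then have "sign ?\<tau> = sign \<sigma> * sign (block_swap n m)"
      by (rule sign_compose)
    then have "sgn_perm ?\<tau> = (-1) ^ (m * n) * sgn_perm \<sigma>"
      using block_swap_sign[of n m] by (simp only: of_int_mult) (simp add: mult.commute)
    moreover have "subargs us ?\<tau> n (m + n) = subargs us \<sigma> 0 m" "subargs us ?\<tau> 0 n = subargs us \<sigma> m (m + n)"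
      using subargs_block_swap[of us \<sigma> n m] by (simp_all add: add.commute)
    \<comment> \<open>The two factors \<open>(-1) ^ (m * n)\<close> cancel, since their exponents
      add up to an even number.\<close>
    ultimately show "(-1) ^ (m * n) *\<^sub>R
        (sgn_perm ?\<tau> *\<^sub>R h (subargs us ?\<tau> n (m + n)) (subargs us ?\<tau> 0 n))
      = sgn_perm \<sigma> *\<^sub>R h (subargs us \<sigma> 0 m) (subargs us \<sigma> m (m + n))"
      by (simp flip: power_add mult.assoc)
  next
    fix \<sigma> assume \<sigma>: "\<sigma> \<in> unshuffles [int n, int m]"
    show "(\<sigma> \<circ> block_swap m n) \<circ> block_swap n m = \<sigma>"
      by (simp add: comp_assoc block_swap_block_swap)
    show "\<sigma> \<circ> block_swap m n \<in> unshuffles [int m, int n]"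
      using \<sigma> by (rule block_swap_unshuffles)
  qed
  then show ?thesis
    by (simp only: product_sum_def scaleR_right.sum add.commute[of n m])
qed

text \<open>The permutation maps indices below \<open>length ws\<close> to such indices, so entries
  of \<open>zs\<close> are never selected. It is used with \<open>zs = [w]\<close>, the argument
  that the unshuffles in \<open>der_comp\<close> leave in the last place.\<close>

lemma subargs_append:
  assumes "\<sigma> permutes {..<length ws}" "j \<le> length ws"
  shows "subargs (ws @ zs) \<sigma> i j = subargs ws \<sigma> i j"
  using permutes_in_image[OF assms(1)] assms(2)
  by (auto simp: subargs_def nth_append)

lemma subargs_tuples:
  assumes "ws \<in> tuples S k" "\<sigma> permutes {..<k}" "j \<le> k"
  shows "subargs ws \<sigma> i j \<in> tuples S (j - i)"
  using permutes_in_image[OF assms(2)] assms(1,3)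
  by (auto simp: subargs_def tuples_def subset_iff)

lemma nth_permutes_tuples: "ws \<in> tuples S k \<Longrightarrow> \<sigma> permutes {..<k} \<Longrightarrow> i < k \<Longrightarrow> ws ! \<sigma> i \<in> S"
  using permutes_in_image[of \<sigma> "{..<k}" i] by (auto simp: tuples_def subset_iff)

lemma unshuffles_neg: "b \<in> set bs \<Longrightarrow> b < 0 \<Longrightarrow> unshuffles bs = {}"
  by (auto simp: unshuffles_def)

lemma sum_fun_apply: "(\<Sum>i\<in>I. f i) x = (\<Sum>i\<in>I. f i x)"
  by (induction I rule: infinite_finite_induct) simp_all

section \<open>Smoothness\<close>

lemma C_k_on_subset: "C_k_on k T f \<Longrightarrow> S \<subseteq> T \<Longrightarrow> C_k_on k S f"
  by (induction k arbitrary: f) (auto intro: continuous_on_subset)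

lemma C_k_on_Suc_imp: "C_k_on (Suc k) S f \<Longrightarrow> C_k_on k S f"
proof (induction k arbitrary: f)
  case 0
  then show ?case
    by (auto intro!: continuous_at_imp_continuous_on differentiable_imp_continuous_within)
next
  case (Suc k)
  then have "C_k_on k S (\<lambda>x. frechet_derivative f (at x) v)" for v
    using C_k_on.simps(2) by blast
  then show ?case using Suc.prems by simp
qed

text \<open>The derivative at x depends on a full neighbourhood of x; agreement on \<open>S\<close>
  passes to the derivatives because \<open>S\<close> is open.\<close>

lemma C_k_on_cong:
  assumes "open S" "\<And>x. x \<in> S \<Longrightarrow> f x = g x" "C_k_on k S f"
  shows "C_k_on k S g"
  using assms(2,3)
proof (induction k arbitrary: f g)
  case 0
  then show ?case by (metis C_k_on.simps(1) continuous_on_cong)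
next
  case (Suc k)
  have "g differentiable at x" if "x \<in> S" for x
    using Suc.prems that has_derivative_transform_within_open[OF _ \<open>open S\<close> that]
    by (simp add: differentiable_def) blast
  moreover have "C_k_on k S (\<lambda>x. frechet_derivative g (at x) v)" for v
  proof (rule Suc.IH)
    show "frechet_derivative f (at x) v = frechet_derivative g (at x) v" if "x \<in> S" for x
      using frechet_derivative_transform_within_open[of f x S g] Suc.prems \<open>open S\<close> that by simp
    show "C_k_on k S (\<lambda>x. frechet_derivative f (at x) v)"
      using Suc.prems by simp
  qed
  ultimately show ?case by simp
qed

text \<open>All clauses of \<open>C_k_on\<close> are local: on an open \<open>T\<close>, continuity
  is continuity at each point, and in the induction the same \<open>T\<close> serves the derivatives
  in all directions.\<close>

lemma C_k_on_local:
  assumes "\<And>x. x \<in> S \<Longrightarrow> \<exists>T. open T \<and> x \<in> T \<and> C_k_on k T f"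
  shows "C_k_on k S f"
  using assms
proof (induction k arbitrary: f)
  case 0
  then show ?case
    by (auto intro!: continuous_at_imp_continuous_on) (metis continuous_on_eq_continuous_at)
next
  case (Suc k)
  then show ?case by simp meson
qed

lemma C_k_on_const [simp]: "C_k_on k S (\<lambda>x. c)"
  by (induction k arbitrary: c) simp_all

text \<open>A bounded linear map commutes with differentiation, so the derivatives of the composite
  have the same form and the induction applies to them.\<close>

lemma C_k_on_bounded_linear:
  assumes "bounded_linear L" "open S" "C_k_on k S f"
  shows "C_k_on k S (\<lambda>x. L (f x))"
  using assms(3)
proof (induction k arbitrary: f)
  case 0
  then show ?case
    using assms(1) by (auto intro: linear_continuous_on_compose bounded_linear.continuous_on)
next
  case (Suc k)
  have d: "((\<lambda>x. L (f x)) has_derivative (\<lambda>v. L (frechet_derivative f (at x) v))) (at x)"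
    if "x \<in> S" for x
    using Suc.prems that
    by (intro bounded_linear.has_derivative[OF assms(1)]) (simp_all flip: frechet_derivative_works)
  moreover have "C_k_on k S (\<lambda>x. frechet_derivative (\<lambda>x. L (f x)) (at x) v)" for v
  proof (rule C_k_on_cong[OF \<open>open S\<close>])
    show "C_k_on k S (\<lambda>x. L (frechet_derivative f (at x) v))"
      using Suc by simp
  qed (rule fun_cong[OF frechet_derivative_at[OF d]])
  ultimately show ?case by (auto simp: differentiable_def)
qed

lemma C_k_on_add:
  assumes "open S" "C_k_on k S f" "C_k_on k S g"
  shows "C_k_on k S (\<lambda>x. f x + g x)"
  using assms(2,3)
proof (induction k arbitrary: f g)
  case 0
  then show ?case by (auto intro: continuous_on_add)
next
  case (Suc k)
  have d: "((\<lambda>x. f x + g x) has_derivative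
      (\<lambda>v. frechet_derivative f (at x) v + frechet_derivative g (at x) v)) (at x)" if "x \<in> S" for x
    using Suc.prems that
    by (intro has_derivative_add) (simp_all flip: frechet_derivative_works)
  moreover have "C_k_on k S (\<lambda>x. frechet_derivative (\<lambda>x. f x + g x) (at x) v)" for v
  proof (rule C_k_on_cong[OF \<open>open S\<close>])
    show "C_k_on k S (\<lambda>x. frechet_derivative f (at x) v + frechet_derivative g (at x) v)"
      using Suc by simp
  qed (rule fun_cong[OF frechet_derivative_at[OF d]])
  ultimately show ?case by (auto simp: differentiable_def)
qed

lemma C_k_on_scaleR:
  assumes "open S" "C_k_on k S f" "C_k_on k S g"
  shows "C_k_on k S (\<lambda>x. f x *\<^sub>R g x)"
  using assms(2,3)
proof (induction k arbitrary: f g)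
  case 0
  then show ?case by (auto intro: continuous_on_scaleR)
next
  case (Suc k)
  have d: "((\<lambda>x. f x *\<^sub>R g x) has_derivative
      (\<lambda>v. f x *\<^sub>R frechet_derivative g (at x) v + frechet_derivative f (at x) v *\<^sub>R g x)) (at x)"
    if "x \<in> S" for x
    using Suc.prems that
    by (intro has_derivative_scaleR) (simp_all flip: frechet_derivative_works)
  moreover have "C_k_on k S (\<lambda>x. frechet_derivative (\<lambda>x. f x *\<^sub>R g x) (at x) v)" for v
  proof (rule C_k_on_cong[OF \<open>open S\<close>])
    show "C_k_on k S (\<lambda>x. f x *\<^sub>R frechet_derivative g (at x) v + frechet_derivative f (at x) v *\<^sub>R g x)"
      \<comment> \<open>The product rule leaves \<open>f\<close> and \<open>g\<close> themselves
        next to derivatives, so both are lowered from order k + 1 to k before the induction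
        hypothesis is applied.\<close>
      using Suc.prems Suc.prems[THEN C_k_on_Suc_imp] by (intro C_k_on_add[OF \<open>open S\<close>] Suc.IH) auto
  qed (rule fun_cong[OF frechet_derivative_at[OF d]])
  ultimately show ?case by (auto simp: differentiable_def)
qed

section \<open>Smooth maps on a manifold, read in charts\<close>

context smooth_manifold
begin

lemma inv_chart: "(U, \<phi>) \<in> atlas \<Longrightarrow> x \<in> U \<Longrightarrow> inv_into U \<phi> (\<phi> x) = x"
  using chart_homeomorphism by (auto simp: homeomorphism_def)

text \<open>A chart is a homeomorphism onto its image, which is itself open in the model
  space.\<close>

lemma open_chart_image:
  assumes "(U, \<phi>) \<in> atlas" "open S"
  shows "open (\<phi> ` (S \<inter> U))"
proof -
  have "openin (top_of_set (\<phi> ` U)) (\<phi> ` (S \<inter> U))"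
    using homeomorphism_imp_open_map[OF chart_homeomorphism[OF assms(1)]] assms(2)
    by (metis Int_commute openin_open_Int)
  then show ?thesis
    using open_image[OF assms(1)] openin_open_trans by blast
qed

lemma mfd_smooth_onI:
  assumes "\<And>U \<phi> k. (U, \<phi>) \<in> atlas \<Longrightarrow> C_k_on k (\<phi> ` (S \<inter> U)) (f \<circ> inv_into U \<phi>)"
  shows "mfd_smooth_on atlas S f"
  using assms by (auto simp: mfd_smooth_on_def smooth_on_def)

lemma mfd_smooth_onD:
  "mfd_smooth_on atlas S f \<Longrightarrow> (U, \<phi>) \<in> atlas \<Longrightarrow> C_k_on k (\<phi> ` (S \<inter> U)) (f \<circ> inv_into U \<phi>)"
  by (auto simp: mfd_smooth_on_def smooth_on_def)

lemma mfd_smooth_on_subset: "mfd_smooth_on atlas T f \<Longrightarrow> S \<subseteq> T \<Longrightarrow> mfd_smooth_on atlas S f"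
  by (rule mfd_smooth_onI, rule C_k_on_subset, erule (1) mfd_smooth_onD) auto

lemma mfd_smooth_on_cong:
  assumes "open S" "mfd_smooth_on atlas S f" "\<And>x. x \<in> S \<Longrightarrow> f x = g x"
  shows "mfd_smooth_on atlas S g"
proof (rule mfd_smooth_onI)
  fix U \<phi> k assume "(U, \<phi>) \<in> atlas"
  then show "C_k_on k (\<phi> ` (S \<inter> U)) (g \<circ> inv_into U \<phi>)"
    using assms by (intro C_k_on_cong[OF open_chart_image _ mfd_smooth_onD]) (auto simp: inv_chart)
qed

lemma mfd_smooth_on_local:
  assumes "\<And>x. x \<in> S \<Longrightarrow> \<exists>T. open T \<and> x \<in> T \<and> mfd_smooth_on atlas T f"
  shows "mfd_smooth_on atlas S f"
proof (intro mfd_smooth_onI C_k_on_local)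
  fix U \<phi> k y assume U: "(U, \<phi>) \<in> atlas" and "y \<in> \<phi> ` (S \<inter> U)"
  then obtain x where "x \<in> S" "x \<in> U" "y = \<phi> x" by blast
  with assms obtain T where "open T" "x \<in> T" "mfd_smooth_on atlas T f" by blast
  \<comment> \<open>The witness is the image of \<open>T \<inter> U\<close> under the chart, which
    is open and contains y.\<close>
  then show "\<exists>T. open T \<and> y \<in> T \<and> C_k_on k T (f \<circ> inv_into U \<phi>)"
    using open_chart_image[OF U] mfd_smooth_onD[OF _ U] \<open>x \<in> U\<close> \<open>y = \<phi> x\<close> by blast
qed

lemma mfd_smooth_on_const: "mfd_smooth_on atlas S (\<lambda>x. c)"
  by (rule mfd_smooth_onI) (simp add: o_def)

lemma mfd_smooth_on_bounded_linear:
  assumes "bounded_linear L" "open S" "mfd_smooth_on atlas S f"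
  shows "mfd_smooth_on atlas S (\<lambda>x. L (f x))"
  using assms C_k_on_bounded_linear[OF assms(1) open_chart_image mfd_smooth_onD]
  by (intro mfd_smooth_onI) (auto simp: o_def)

lemma mfd_smooth_on_add:
  assumes "open S" "mfd_smooth_on atlas S f" "mfd_smooth_on atlas S g"
  shows "mfd_smooth_on atlas S (\<lambda>x. f x + g x)"
  using assms C_k_on_add[OF open_chart_image mfd_smooth_onD mfd_smooth_onD]
  by (intro mfd_smooth_onI) (auto simp: o_def)

lemma mfd_smooth_on_scaleR:
  assumes "open S" "mfd_smooth_on atlas S f" "mfd_smooth_on atlas S g"
  shows "mfd_smooth_on atlas S (\<lambda>x. f x *\<^sub>R g x)"
  using assms C_k_on_scaleR[OF open_chart_image mfd_smooth_onD mfd_smooth_onD]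
  by (intro mfd_smooth_onI) (auto simp: o_def)

lemma mfd_smooth_on_sum:
  assumes "open S" "\<And>i. i \<in> I \<Longrightarrow> mfd_smooth_on atlas S (f i)"
  shows "mfd_smooth_on atlas S (\<lambda>x. \<Sum>i\<in>I. f i x)"
  using assms(2)
  by (induction I rule: infinite_finite_induct)
    (auto intro: mfd_smooth_on_const mfd_smooth_on_add[OF assms(1)])

end

section \<open>Orthonormal expansions\<close>

lemma fin_dim_expansion:
  "\<exists>B :: 'b::fin_dim set. finite B \<and> (\<forall>x. (\<Sum>b\<in>B. (x \<bullet> b) *\<^sub>R b) = x)"
proof -
  obtain B :: "'b set" where B: "finite B"
      "\<And>u v. u \<in> B \<Longrightarrow> v \<in> B \<Longrightarrow> u \<bullet> v = (if u = v then 1 else 0)"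
      "\<And>x. (\<forall>u\<in>B. x \<bullet> u = 0) \<longleftrightarrow> x = 0"
    using orthonormal_basis_exists by metis
  \<comment> \<open>The remainder of the expansion is orthogonal to all of \<open>B\<close>, hence
    zero by the last property of \<open>B\<close>.\<close>
  have "(x - (\<Sum>b\<in>B. (x \<bullet> b) *\<^sub>R b)) \<bullet> u = 0" if "u \<in> B" for x u
  proof -
    have "(\<Sum>b\<in>B. (x \<bullet> b) *\<^sub>R b) \<bullet> u = (\<Sum>b\<in>B. if b = u then x \<bullet> u else 0)"
      unfolding inner_sum_left using that by (intro sum.cong) (auto simp: B(2))
    then show ?thesis using that \<open>finite B\<close> by (simp add: inner_diff_left)
  qed
  then have "(\<Sum>b\<in>B. (x \<bullet> b) *\<^sub>R b) = x" for x
    using B(3)[of "x - (\<Sum>b\<in>B. (x \<bullet> b) *\<^sub>R b)"] by simp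
  with \<open>finite B\<close> show ?thesis by blast
qed

lemma tuples_update: "us \<in> tuples S k \<Longrightarrow> u \<in> S \<Longrightarrow> us[i := u] \<in> tuples S k"
  using set_update_subset_insert[of us i u] by (auto simp: tuples_def)

lemma multilinear_on_sum:
  assumes "multilinear_on S k F" "subspace S" "us \<in> tuples S k" "i < k"
    and "finite B" "\<And>b. b \<in> B \<Longrightarrow> w b \<in> S"
  shows "F (us[i := \<Sum>b\<in>B. c b *\<^sub>R w b]) = (\<Sum>b\<in>B. c b *\<^sub>R F (us[i := w b]))"
  using assms(5,6)
proof (induction B)
  case empty
  \<comment> \<open>The empty sum is written as \<open>0 *\<^sub>R 0\<close>, so that homogeneity in
    slot i gives the value 0.\<close>
  have "F (us[i := 0 *\<^sub>R 0]) = 0 *\<^sub>R F (us[i := 0])"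
    using assms(1-4) subspace_0 unfolding multilinear_on_def by blast
  then show ?case by simp
next
  case (insert b B)
  have "c b *\<^sub>R w b \<in> S" "(\<Sum>b\<in>B. c b *\<^sub>R w b) \<in> S" "w b \<in> S"
    using insert.prems \<open>subspace S\<close> by (auto intro!: subspace_scale subspace_sum)
  then show ?case
    using insert assms(1,3,4) by (simp add: multilinear_on_def)
qed

section \<open>Local frames and sections of a vector bundle\<close>

context vector_bundle
begin

text \<open>The local section whose component in the trivialization is the constant z. For z running
  through a basis of the model fibre these sections form a local frame.\<close>

abbreviation frame :: "('m \<Rightarrow> 'e \<Rightarrow> 'f) \<Rightarrow> 'f \<Rightarrow> 'm \<Rightarrow> 'e" where
  "frame \<tau> z x \<equiv> inv_into (fibre E x) (\<tau> x) z"

lemma frame_in_fibre: "(U, \<tau>) \<in> trivs E \<Longrightarrow> x \<in> U \<Longrightarrow> frame \<tau> z x \<in> fibre E x"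
  using triv_bij by (metis UNIV_I bij_betw_imp_surj_on inv_into_into)

lemma triv_frame: "(U, \<tau>) \<in> trivs E \<Longrightarrow> x \<in> U \<Longrightarrow> \<tau> x (frame \<tau> z x) = z"
  using triv_bij by (metis UNIV_I bij_betw_inv_into_right)

lemma triv_sum:
  assumes "(U, \<tau>) \<in> trivs E" "x \<in> U" "finite B" "\<And>b. b \<in> B \<Longrightarrow> w b \<in> fibre E x"
  shows "\<tau> x (\<Sum>b\<in>B. c b *\<^sub>R w b) = (\<Sum>b\<in>B. c b *\<^sub>R \<tau> x (w b))"
  using assms(3,4)
proof (induction B)
  case empty
  show ?case
    using triv_scale[OF assms(1,2) subspace_0[OF subspace_fibre], of 0] by simp
next
  case (insert b B)
  then have "c b *\<^sub>R w b \<in> fibre E x" "(\<Sum>b\<in>B. c b *\<^sub>R w b) \<in> fibre E x" "w b \<in> fibre E x"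
    using subspace_fibre by (auto intro!: subspace_scale subspace_sum)
  then show ?case
    using insert by (simp add: triv_add[OF assms(1,2)] triv_scale[OF assms(1,2)])
qed

text \<open>Both sides lie in the fibre and have the same image under \<open>\<tau> x\<close>, which
  is injective there.\<close>

lemma frame_expansion:
  assumes "(U, \<tau>) \<in> trivs E" "x \<in> U" "v \<in> fibre E x"
    and B: "finite B" "\<forall>z :: 'f. (\<Sum>b\<in>B. (z \<bullet> b) *\<^sub>R b) = z"
  shows "(\<Sum>b\<in>B. (\<tau> x v \<bullet> b) *\<^sub>R frame \<tau> b x) = v"
proof -
  let ?w = "\<Sum>b\<in>B. (\<tau> x v \<bullet> b) *\<^sub>R frame \<tau> b x"
  have "?w \<in> fibre E x"
    using assms(1-4) subspace_fibre by (auto intro!: subspace_scale subspace_sum frame_in_fibre)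
  moreover have "\<tau> x ?w = \<tau> x v"
    using triv_sum[OF assms(1,2) B(1)] frame_in_fibre[OF assms(1,2)] triv_frame[OF assms(1,2)]
      B(2) by simp
  ultimately show ?thesis
    using inj_onD[OF bij_betw_imp_inj_on[OF triv_bij[OF assms(1,2)]]] assms(3) by simp
qed

lemma mfd_smooth_on_multilinear:
  assumes U: "(U, \<tau>) \<in> trivs E" and W: "open W" "W \<subseteq> U"
    and G: "\<And>x. x \<in> W \<Longrightarrow> multilinear_on (fibre E x) k (G x)"
    and smooth: "\<And>zs. length zs = k \<Longrightarrow> mfd_smooth_on atlas W (\<lambda>x. G x (map (\<lambda>z. frame \<tau> z x) zs))"
    and us: "length us = k" "\<And>u x. u \<in> set us \<Longrightarrow> x \<in> W \<Longrightarrow> u x \<in> fibre E x"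
      "\<And>u. u \<in> set us \<Longrightarrow> mfd_smooth_on atlas W (\<lambda>x. \<tau> x (u x))"
  shows "mfd_smooth_on atlas W (\<lambda>x. G x (map (\<lambda>u. u x) us))"
proof -
  obtain B :: "'f set" where B: "finite B" "\<forall>z. (\<Sum>b\<in>B. (z \<bullet> b) *\<^sub>R b) = z"
    using fin_dim_expansion by blast
  \<comment> \<open>Generalised to sections followed by frame elements: the induction removes
    sections from the right and prepends the basis vectors replacing them to
    \<open>zs\<close>.\<close>
  have "mfd_smooth_on atlas W (\<lambda>x. G x (map (\<lambda>u. u x) us @ map (\<lambda>z. frame \<tau> z x) zs))"
    if "length us + length zs = k" for zs
    using that us(2,3)
  proof (induction us arbitrary: zs rule: rev_induct)
    case Nil
    then show ?case using smooth by simp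
  next
    case (snoc u us)
    have "mfd_smooth_on atlas W (\<lambda>x. \<Sum>b\<in>B. (\<tau> x (u x) \<bullet> b) *\<^sub>R
        G x (map (\<lambda>u. u x) us @ map (\<lambda>z. frame \<tau> z x) (b # zs)))"
    proof (rule mfd_smooth_on_sum[OF W(1)], rule mfd_smooth_on_scaleR[OF W(1)])
      show "mfd_smooth_on atlas W (\<lambda>x. \<tau> x (u x) \<bullet> b)" for b
        using snoc.prems by (intro mfd_smooth_on_bounded_linear[OF bounded_linear_inner_left W(1)]) simp
      show "mfd_smooth_on atlas W
          (\<lambda>x. G x (map (\<lambda>u. u x) us @ map (\<lambda>z. frame \<tau> z x) (b # zs)))" for b
        by (rule snoc.IH) (use snoc.prems in simp_all)
    qed
    moreover have "(\<Sum>b\<in>B. (\<tau> x (u x) \<bullet> b) *\<^sub>R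
        G x (map (\<lambda>u. u x) us @ map (\<lambda>z. frame \<tau> z x) (b # zs)))
      = G x (map (\<lambda>u. u x) (us @ [u]) @ map (\<lambda>z. frame \<tau> z x) zs)" if "x \<in> W" for x
    proof -
      let ?vs = "map (\<lambda>u. u x) (us @ [u]) @ map (\<lambda>z. frame \<tau> z x) zs"
      \<comment> \<open>Position \<open>length us\<close> is the slot of \<open>u\<close>, the only
        one that is expanded here.\<close>
      have upd: "?vs[length us := v] = map (\<lambda>u. u x) us @ v # map (\<lambda>z. frame \<tau> z x) zs" for v
        by (simp add: list_update_append)
      have x: "x \<in> U" using that W by blast
      have "?vs \<in> tuples (fibre E x) k"
        using snoc.prems that frame_in_fibre[OF U x] by (auto simp: tuples_def)
      then have "G x (?vs[length us := \<Sum>b\<in>B. (\<tau> x (u x) \<bullet> b) *\<^sub>R frame \<tau> b x])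
          = (\<Sum>b\<in>B. (\<tau> x (u x) \<bullet> b) *\<^sub>R G x (?vs[length us := frame \<tau> b x]))"
        using snoc.prems that frame_in_fibre[OF U x] B(1)
        by (intro multilinear_on_sum[OF G[OF that] subspace_fibre]) auto
      moreover have "(\<Sum>b\<in>B. (\<tau> x (u x) \<bullet> b) *\<^sub>R frame \<tau> b x) = u x"
        using snoc.prems that by (intro frame_expansion[OF U x _ B]) auto
      ultimately show ?thesis unfolding upd by simp
    qed
    ultimately show ?case
      by (rule mfd_smooth_on_cong[OF W(1)])
  qed
  from this[of "[]"] show ?thesis using us(1) by simp
qed


lemma triv_exists: obtains U \<tau> where "(U, \<tau>) \<in> trivs E" "x \<in> U"
proof -
  have "x \<in> (\<Union>(U, \<tau>)\<in>trivs E. U)"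
    by (simp add: trivs_cover)
  then obtain c where "c \<in> trivs E" "x \<in> (case c of (U, \<tau>) \<Rightarrow> U)"
    by (rule UN_E)
  then show ?thesis
    by (cases c) (simp add: that)
qed

lemma triv_zero: "(U, \<tau>) \<in> trivs E \<Longrightarrow> x \<in> U \<Longrightarrow> \<tau> x 0 = 0"
  using triv_sum[of U \<tau> x "{}"] by simp

lemma sections_fun_mult:
  assumes "f \<in> smooth_functions atlas" "u \<in> sections atlas E"
  shows "f \<cdot> u \<in> sections atlas E"
proof -
  have "mfd_smooth_on atlas U (\<lambda>x. \<tau> x (f x *\<^sub>R u x))" if U: "(U, \<tau>) \<in> trivs E" for U \<tau>
  proof (rule mfd_smooth_on_cong[OF triv_open[OF U]])
    show "mfd_smooth_on atlas U (\<lambda>x. f x *\<^sub>R \<tau> x (u x))"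
      using assms U
      by (intro mfd_smooth_on_scaleR[OF triv_open[OF U]])
        (auto simp: sections_def smooth_functions_def intro: mfd_smooth_on_subset)
    show "f x *\<^sub>R \<tau> x (u x) = \<tau> x (f x *\<^sub>R u x)" if "x \<in> U" for x
      using triv_scale[OF U that] assms(2) by (simp add: sections_def)
  qed
  then show ?thesis
    using assms(2) subspace_fibre by (auto simp: sections_def fun_mult_def subspace_scale)
qed

lemma const_smooth: "(\<lambda>_. c) \<in> smooth_functions atlas"
  by (simp add: smooth_functions_def mfd_smooth_on_const)

text \<open>Turns questions about real scalars into questions about multiplication by smooth
  functions.\<close>

lemma scaleR_eq_fun_mult: "c *\<^sub>R u = (\<lambda>_. c) \<cdot> u"
  by (simp add: scaleR_fun_def fun_mult_def)

lemma subspace_sections: "subspace (sections atlas E)"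
proof (rule subspaceI)
  have "mfd_smooth_on atlas U (\<lambda>x. \<tau> x 0)" if "(U, \<tau>) \<in> trivs E" for U \<tau>
    by (rule mfd_smooth_on_cong[OF triv_open[OF that] mfd_smooth_on_const[of _ 0]])
      (simp add: triv_zero[OF that])
  then show "0 \<in> sections atlas E"
    using subspace_fibre by (auto simp: sections_def subspace_0)
next
  fix u v assume uv: "u \<in> sections atlas E" "v \<in> sections atlas E"
  have "mfd_smooth_on atlas U (\<lambda>x. \<tau> x (u x + v x))" if U: "(U, \<tau>) \<in> trivs E" for U \<tau>
  proof (rule mfd_smooth_on_cong[OF triv_open[OF U]])
    show "mfd_smooth_on atlas U (\<lambda>x. \<tau> x (u x) + \<tau> x (v x))"
      using uv U by (intro mfd_smooth_on_add[OF triv_open[OF U]]) (auto simp: sections_def)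
    show "\<tau> x (u x) + \<tau> x (v x) = \<tau> x (u x + v x)" if "x \<in> U" for x
      using triv_add[OF U that] uv by (simp add: sections_def)
  qed
  then show "u + v \<in> sections atlas E"
    using uv subspace_fibre by (auto simp: sections_def subspace_add)
next
  show "c *\<^sub>R u \<in> sections atlas E" if "u \<in> sections atlas E" for c u
    unfolding scaleR_eq_fun_mult using that by (rule sections_fun_mult[OF const_smooth])
qed

end

section \<open>Rules for multilinear maps and tuples\<close>

lemma multilinear_on_comp:
  assumes "multilinear_on S k F" "\<And>vs. vs \<in> tuples S k \<Longrightarrow> F vs \<in> T"
    and "\<And>v w. v \<in> T \<Longrightarrow> w \<in> T \<Longrightarrow> g (v + w) = g v + g w"
    and "\<And>c v. v \<in> T \<Longrightarrow> g (c *\<^sub>R v) = c *\<^sub>R g v"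
  shows "multilinear_on S k (\<lambda>vs. g (F vs))"
  using assms by (simp add: multilinear_on_def tuples_update)

lemma multilinear_on_add:
  "multilinear_on S k F \<Longrightarrow> us \<in> tuples S k \<Longrightarrow> i < k \<Longrightarrow> u \<in> S \<Longrightarrow> v \<in> S \<Longrightarrow>
    F (us[i := u + v]) = F (us[i := u]) + F (us[i := v])"
  and multilinear_on_scale:
  "multilinear_on S k F \<Longrightarrow> us \<in> tuples S k \<Longrightarrow> i < k \<Longrightarrow> u \<in> S \<Longrightarrow>
    F (us[i := c *\<^sub>R u]) = c *\<^sub>R F (us[i := u])"
  unfolding multilinear_on_def by blast+

lemma tuples_length: "us \<in> tuples S k \<Longrightarrow> length us = k"
  and tuples_mem: "us \<in> tuples S k \<Longrightarrow> u \<in> set us \<Longrightarrow> u \<in> S"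
  by (auto simp: tuples_def)

text \<open>Separates the last argument, on which \<Phi>(P) acts through \<rho>, from those that are
  fed to P.\<close>

lemma tuples_Suc_iff: "us \<in> tuples S (Suc k) \<longleftrightarrow> (\<exists>ws w. us = ws @ [w] \<and> ws \<in> tuples S k \<and> w \<in> S)"
proof
  assume "us \<in> tuples S (Suc k)"
  then show "\<exists>ws w. us = ws @ [w] \<and> ws \<in> tuples S k \<and> w \<in> S"
    by (cases us rule: rev_cases) (auto simp: tuples_def)
qed (auto simp: tuples_def)

section \<open>Cochains and their images\<close>

lemma hom_sections_fibre:
  "p \<in> hom_sections atlas E F k \<Longrightarrow> vs \<in> tuples (fibre E x) k \<Longrightarrow> p x vs \<in> fibre F x"
  by (simp add: hom_sections_def)

lemma hom_sections_multilinear: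
  "p \<in> hom_sections atlas E F k \<Longrightarrow> multilinear_on (fibre E x) k (p x)"
  by (simp add: hom_sections_def)

lemma hom_sections_smooth:
  assumes p: "p \<in> hom_sections atlas E F k"
    and U: "(U, \<tau>) \<in> trivs E" and V: "(V, \<kappa>) \<in> trivs F" and zs: "length zs = k"
  shows "mfd_smooth_on atlas (U \<inter> V)
    (\<lambda>x. \<kappa> x (p x (map (\<lambda>z. inv_into (fibre E x) (\<tau> x) z) zs)))"
proof -
  have "\<forall>(U, \<tau>)\<in>trivs E. \<forall>(V, \<kappa>)\<in>trivs F. \<forall>zs. length zs = k \<longrightarrow> mfd_smooth_on atlas (U \<inter> V)
    (\<lambda>x. \<kappa> x (p x (map (\<lambda>z. inv_into (fibre E x) (\<tau> x) z) zs)))"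
    using p unfolding hom_sections_def by (elim CollectE conjE)
  from bspec[OF this U] have "\<forall>(V, \<kappa>)\<in>trivs F. \<forall>zs. length zs = k \<longrightarrow> mfd_smooth_on atlas (U \<inter> V)
    (\<lambda>x. \<kappa> x (p x (map (\<lambda>z. inv_into (fibre E x) (\<tau> x) z) zs)))"
    by simp
  from bspec[OF this V] zs show ?thesis by simp
qed

lemma sectionsI:
  assumes "\<And>x. s x \<in> fibre E x"
    and "\<And>U \<tau>. (U, \<tau>) \<in> trivs E \<Longrightarrow> mfd_smooth_on atlas U (\<lambda>x. \<tau> x (s x))"
  shows "s \<in> sections atlas E"
proof -
  have "case c of (U, \<tau>) \<Rightarrow> mfd_smooth_on atlas U (\<lambda>x. \<tau> x (s x))" if "c \<in> trivs E" for c
    using assms(2) that by (cases c) simp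
  then show ?thesis
    using assms(1) by (simp add: sections_def)
qed

lemma sections_fibre: "u \<in> sections atlas E \<Longrightarrow> u x \<in> fibre E x"
  by (simp add: sections_def)

lemma sections_smooth:
  assumes "u \<in> sections atlas E" "(U, \<tau>) \<in> trivs E"
  shows "mfd_smooth_on atlas U (\<lambda>x. \<tau> x (u x))"
proof -
  have "\<forall>(U, \<tau>)\<in>trivs E. mfd_smooth_on atlas U (\<lambda>x. \<tau> x (u x))"
    using assms(1) unfolding sections_def by (elim CollectE conjE)
  from bspec[OF this assms(2)] show ?thesis by simp
qed

context lie_rep_pair
begin

lemma section_values: "us \<in> tuples (sections atlas E) k \<Longrightarrow> map (\<lambda>u. u x) us \<in> tuples (fibre E x) k"
  by (auto simp: tuples_def sections_def)

text \<open>Membership in the fibres holds pointwise. Smoothness is checked near each point, on a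
  neighbourhood where \<open>E\<close> is trivialized too, with \<open>G\<close> the fibre map
  \<open>p\<close> followed by the trivialization of \<open>A\<close>.\<close>

lemma hom_sections_apply:
  assumes p: "p \<in> hom_sections atlas E A k" and us: "us \<in> tuples (sections atlas E) k"
  shows "(\<lambda>x. p x (map (\<lambda>u. u x) us)) \<in> sections atlas A"
proof -
  have "mfd_smooth_on atlas V (\<lambda>x. \<kappa> x (p x (map (\<lambda>u. u x) us)))" if V: "(V, \<kappa>) \<in> trivs A" for V \<kappa>
  proof (rule mfd_smooth_on_local)
    fix x assume "x \<in> V"
    obtain U \<tau> where U: "(U, \<tau>) \<in> trivs E" "x \<in> U"
      by (rule E.triv_exists)
    have W: "open (U \<inter> V)"
      using E.triv_open[OF U(1)] triv_open[OF V] by blast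
    have "mfd_smooth_on atlas (U \<inter> V) (\<lambda>x. \<kappa> x (p x (map (\<lambda>u. u x) us)))"
    proof (rule E.mfd_smooth_on_multilinear[OF U(1) W,
          where k = k and G = "\<lambda>x vs. \<kappa> x (p x vs)" and us = us])
      show "multilinear_on (fibre E y) k (\<lambda>vs. \<kappa> y (p y vs))" if "y \<in> U \<inter> V" for y
      proof (rule multilinear_on_comp[OF hom_sections_multilinear[OF p]])
        show "p y vs \<in> fibre A y" if "vs \<in> tuples (fibre E y) k" for vs
          using hom_sections_fibre[OF p that] .
      qed (use that triv_add[OF V] triv_scale[OF V] in auto)
      show "mfd_smooth_on atlas (U \<inter> V) (\<lambda>x. \<kappa> x (p x (map (\<lambda>z. E.frame \<tau> z x) zs)))"
        if "length zs = k" for zs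
        using hom_sections_smooth[OF p U(1) V that] .
      show "u y \<in> fibre E y" if "u \<in> set us" for u y
        by (rule sections_fibre[OF tuples_mem[OF us that]])
      show "mfd_smooth_on atlas (U \<inter> V) (\<lambda>x. \<tau> x (u x))" if "u \<in> set us" for u
        by (rule mfd_smooth_on_subset[OF sections_smooth[OF tuples_mem[OF us that] U(1)]]) blast
      show "length us = k"
        using us by (simp add: tuples_def)
    qed blast
    with W U \<open>x \<in> V\<close> show "\<exists>T. open T \<and> x \<in> T \<and> mfd_smooth_on atlas T (\<lambda>x. \<kappa> x (p x (map (\<lambda>u. u x) us)))"
      by blast
  qed
  then show ?thesis
    by (rule sectionsI[OF hom_sections_fibre[OF p section_values[OF us]]])
qed

text \<open>The anchor is given through maps on one-element lists; multilinearity in the only slot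
  of \<open>[v]\<close> is linearity in v.\<close>

lemma anchor_add: "v \<in> fibre A x \<Longrightarrow> w \<in> fibre A x \<Longrightarrow> anchor x (v + w) = anchor x v + anchor x w"
  and anchor_scale: "v \<in> fibre A x \<Longrightarrow> anchor x (c *\<^sub>R v) = c *\<^sub>R anchor x v"
proof -
  have "multilinear_on (fibre A x) 1 (\<lambda>vs. anchor x (hd vs))"
    by (rule hom_sections_multilinear[OF anchor_bundle_map])
  moreover have "[v] \<in> tuples (fibre A x) 1" if "v \<in> fibre A x" for v
    using that by (simp add: tuples_def)
  ultimately have lin: "anchor x (v + w) = anchor x v + anchor x w \<and> anchor x (c *\<^sub>R v) = c *\<^sub>R anchor x v"
    if "v \<in> fibre A x" "w \<in> fibre A x" for v w c
    using that by (fastforce simp: multilinear_on_def)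
  show "v \<in> fibre A x \<Longrightarrow> w \<in> fibre A x \<Longrightarrow> anchor x (v + w) = anchor x v + anchor x w"
    and "v \<in> fibre A x \<Longrightarrow> anchor x (c *\<^sub>R v) = c *\<^sub>R anchor x v"
    using lin by blast+
qed

lemma anchor_zero: "anchor x 0 = 0"
  using anchor_scale[OF subspace_0[OF subspace_fibre], of x 0] by simp

text \<open>This family becomes the symbol of \<Phi>(P). On a local frame of \<open>E\<close>,
  \<open>p\<close> yields a smooth local section of \<open>A\<close>; expanding that in a frame of
  \<open>A\<close> reduces smoothness to the values of the anchor on frames.\<close>

lemma hom_sections_anchor:
  assumes p: "p \<in> hom_sections atlas E A k"
  shows "(\<lambda>x vs. anchor x (p x vs)) \<in> hom_sections atlas E (tangent_bundle atlas) k"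
proof -
  let ?TM = "tangent_bundle atlas"
  have "anchor x (hd [v]) \<in> fibre ?TM x" if "v \<in> fibre A x" for v x
    using hom_sections_fibre[OF anchor_bundle_map, of "[v]"] that by (simp add: tuples_def)
  then have "anchor x (p x vs) \<in> fibre ?TM x" if "vs \<in> tuples (fibre E x) k" for x vs
    using hom_sections_fibre[OF p that] by simp
  moreover have "multilinear_on (fibre E x) k (\<lambda>vs. anchor x (p x vs))" for x
  proof (rule multilinear_on_comp[OF hom_sections_multilinear[OF p]])
    show "p x vs \<in> fibre A x" if "vs \<in> tuples (fibre E x) k" for vs
      using hom_sections_fibre[OF p that] .
  qed (rule anchor_add anchor_scale; assumption)+
  moreover have "alternating_on (fibre E x) k k (\<lambda>vs. anchor x (p x vs))" for x
    using p anchor_zero by (simp add: hom_sections_def alternating_on_def)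
  moreover have "mfd_smooth_on atlas (U \<inter> V)
      (\<lambda>x. \<theta> x (anchor x (p x (map (\<lambda>z. E.frame \<tau> z x) zs))))"
    if U: "(U, \<tau>) \<in> trivs E" and V: "(V, \<theta>) \<in> trivs ?TM" and zs: "length zs = k" for U \<tau> V \<theta> zs
  proof (rule mfd_smooth_on_local)
    fix x assume x: "x \<in> U \<inter> V"
    \<comment> \<open>A trivialization of the tangent bundle reads off the component in one
      chart.\<close>
    obtain \<phi> where \<phi>: "(V, \<phi>) \<in> atlas" "\<theta> = (\<lambda>x v. v (V, \<phi>))"
      using V by (auto simp: tangent_bundle_def)
    obtain W \<kappa> where W: "(W, \<kappa>) \<in> trivs A" "x \<in> W"
      by (rule triv_exists)
    let ?T = "U \<inter> V \<inter> W"
    let ?s = "\<lambda>x. p x (map (\<lambda>z. E.frame \<tau> z x) zs)"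
    have T: "open ?T"
      using E.triv_open[OF U] triv_open[OF W(1)] open_domain[OF \<phi>(1)] by blast
    have "mfd_smooth_on atlas ?T (\<lambda>x. \<theta> x (anchor x (hd (map (\<lambda>u. u x) [?s]))))"
    proof (rule mfd_smooth_on_multilinear[OF W(1) T,
          where k = 1 and G = "\<lambda>x vs. \<theta> x (anchor x (hd vs))" and us = "[?s]"])
      show "multilinear_on (fibre A y) 1 (\<lambda>vs. \<theta> y (anchor y (hd vs)))" for y
        \<comment> \<open>Reading off a component is linear on all functions of charts, hence
          \<open>T = UNIV\<close>.\<close>
        by (rule multilinear_on_comp[where T = UNIV, OF hom_sections_multilinear[OF anchor_bundle_map]])
          (simp_all add: \<phi>(2) scaleR_fun_def)
      show "mfd_smooth_on atlas ?T (\<lambda>x. \<theta> x (anchor x (hd (map (\<lambda>z. frame \<kappa> z x) ys))))"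
        if "length ys = 1" for ys
      proof (rule mfd_smooth_on_subset)
        show "mfd_smooth_on atlas (W \<inter> V) (\<lambda>x. \<theta> x (anchor x (hd (map (\<lambda>z. frame \<kappa> z x) ys))))"
          using hom_sections_smooth[OF anchor_bundle_map W(1) V that] .
      qed auto
      show "u y \<in> fibre A y" if "u \<in> set [?s]" "y \<in> ?T" for u y
        using that hom_sections_fibre[OF p, of _ y] E.frame_in_fibre[OF U, of y] zs
        by (auto simp: tuples_def image_subset_iff)
      show "mfd_smooth_on atlas ?T (\<lambda>x. \<kappa> x (u x))" if "u \<in> set [?s]" for u
      proof (rule mfd_smooth_on_subset)
        show "mfd_smooth_on atlas (U \<inter> W) (\<lambda>x. \<kappa> x (u x))"
          using hom_sections_smooth[OF p U W(1) zs] that by simp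
      qed auto
    qed auto
    with T x W show "\<exists>T. open T \<and> x \<in> T \<and> mfd_smooth_on atlas T (\<lambda>x. \<theta> x (anchor x (?s x)))"
      by auto
  qed
  ultimately show ?thesis
    by (auto simp: hom_sections_def)
qed

text \<open>Recovers the fibre maps behind the operator, so that its algebraic properties can be
  checked at each point of the base.\<close>

lemma cochain_rep:
  assumes "P \<in> cochains atlas E A k"
  shows "\<exists>p\<in>hom_sections atlas E A k.
    \<forall>us\<in>tuples (sections atlas E) k. P us = (\<lambda>x. p x (map (\<lambda>u. u x) us))"
proof -
  obtain p where "p \<in> hom_sections atlas E A k"
    "P = (\<lambda>us. if us \<in> tuples (sections atlas E) k then (\<lambda>x. p x (map (\<lambda>u. u x) us)) else 0)"
    using assms unfolding cochains_def by (rule imageE)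
  then show ?thesis by (intro bexI[of _ p]) simp_all
qed

lemma cochain_closed:
  assumes "P \<in> cochains atlas E A k" "us \<in> tuples (sections atlas E) k"
  shows "P us \<in> sections atlas A"
proof -
  obtain p where "p \<in> hom_sections atlas E A k" "P us = (\<lambda>x. p x (map (\<lambda>u. u x) us))"
    using cochain_rep[OF assms(1)] assms(2) by blast
  then show ?thesis
    using hom_sections_apply[OF _ assms(2)] by simp
qed

lemma cochain_multilinear:
  assumes "P \<in> cochains atlas E A k"
  shows "multilinear_on (sections atlas E) k P"
proof -
  obtain p where p: "p \<in> hom_sections atlas E A k"
    "\<forall>us\<in>tuples (sections atlas E) k. P us = (\<lambda>x. p x (map (\<lambda>u. u x) us))"
    using cochain_rep[OF assms] by blast
  have ml: "multilinear_on (fibre E x) k (p x)" for x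
    by (rule hom_sections_multilinear[OF p(1)])
  show ?thesis
    unfolding multilinear_on_def
  proof (intro ballI allI impI)
    fix us i u v and c :: real
    assume us: "us \<in> tuples (sections atlas E) k" "i < k"
      and uv: "u \<in> sections atlas E" "v \<in> sections atlas E"
    then have "u + v \<in> sections atlas E" "c *\<^sub>R u \<in> sections atlas E"
      using E.subspace_sections by (auto intro: subspace_add subspace_scale)
    moreover have "u x \<in> fibre E x" "v x \<in> fibre E x" for x
      using uv by (auto simp: sections_def)
    ultimately show "P (us[i := u + v]) = P (us[i := u]) + P (us[i := v]) \<and>
        P (us[i := c *\<^sub>R u]) = c *\<^sub>R P (us[i := u])"
      using multilinear_on_add[OF ml section_values[OF us(1)] us(2)]
        multilinear_on_scale[OF ml section_values[OF us(1)] us(2)] us uv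
      by (simp add: p(2) tuples_update map_update scaleR_fun_def fun_eq_iff)
  qed
qed

text \<open>\<open>P\<close> acts fibrewise, and at each point the value of \<open>f\<close> is a
  scalar that the multilinear fibre map releases.\<close>

lemma cochain_fun_mult:
  assumes "P \<in> cochains atlas E A k" "us \<in> tuples (sections atlas E) k" "i < k"
    and "u \<in> sections atlas E" "f \<in> smooth_functions atlas"
  shows "P (us[i := f \<cdot> u]) = f \<cdot> P (us[i := u])"
proof -
  obtain p where p: "p \<in> hom_sections atlas E A k"
    "\<forall>us\<in>tuples (sections atlas E) k. P us = (\<lambda>x. p x (map (\<lambda>u. u x) us))"
    using cochain_rep[OF assms(1)] by blast
  have "p x ((map (\<lambda>u. u x) us)[i := f x *\<^sub>R u x]) = f x *\<^sub>R p x ((map (\<lambda>u. u x) us)[i := u x])" for x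
    using multilinear_on_scale[OF hom_sections_multilinear[OF p(1)] section_values[OF assms(2)] assms(3)]
      sections_fibre[OF assms(4)] by blast
  then show ?thesis
    using assms(2,4) E.sections_fun_mult[OF assms(5,4)]
    by (simp add: p(2) tuples_update map_update fun_mult_def fun_eq_iff)
qed

lemma cochain_alternating:
  assumes "P \<in> cochains atlas E A k"
  shows "alternating_on (sections atlas E) k k P"
proof -
  obtain p where p: "p \<in> hom_sections atlas E A k"
    "\<forall>us\<in>tuples (sections atlas E) k. P us = (\<lambda>x. p x (map (\<lambda>u. u x) us))"
    using cochain_rep[OF assms] by blast
  have "p x (map (\<lambda>u. u x) us) = 0"
    if "us \<in> tuples (sections atlas E) k" "i < j" "j < k" "us ! i = us ! j" for us i j x
  proof -
    have "alternating_on (fibre E x) k k (p x)"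
      using p(1) by (simp add: hom_sections_def)
    moreover have "map (\<lambda>u. u x) us ! i = map (\<lambda>u. u x) us ! j"
      using that by (simp add: tuples_def)
    ultimately show ?thesis
      using section_values[OF that(1)] that unfolding alternating_on_def by blast
  qed
  then have "P us = 0" if "us \<in> tuples (sections atlas E) k" "i < j" "j < k" "us ! i = us ! j" for us i j
    using that by (simp add: p(2) fun_eq_iff)
  then show ?thesis
    unfolding alternating_on_def by blast
qed

section \<open>Linearity of the representation in its first argument\<close>

lemma rep_scale_left:
  "x \<in> sections atlas A \<Longrightarrow> u \<in> sections atlas E \<Longrightarrow> \<rho> (c *\<^sub>R x) u = c *\<^sub>R \<rho> x u"
  \<comment> \<open>The scalar is read as a constant function, to which linearity over smooth
    functions applies.\<close>
  by (simp add: scaleR_eq_fun_mult rep_fun_left[OF _ _ const_smooth] E.scaleR_eq_fun_mult)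

lemma rep_zero_left: "u \<in> sections atlas E \<Longrightarrow> \<rho> 0 u = 0"
  using rep_scale_left[OF subspace_0[OF subspace_sections], of u 0] by simp

lemma rep_diff_left:
  assumes "x \<in> sections atlas A" "y \<in> sections atlas A" "u \<in> sections atlas E"
  shows "\<rho> (x - y) u = \<rho> x u - \<rho> y u"
  using rep_add_left[of "x - y" y u] assms subspace_diff[OF subspace_sections] by simp

lemma rep_sum_left:
  assumes "u \<in> sections atlas E" "\<And>i. i \<in> I \<Longrightarrow> x i \<in> sections atlas A"
  shows "\<rho> (\<Sum>i\<in>I. x i) u = (\<Sum>i\<in>I. \<rho> (x i) u)"
  using assms(2)
proof (induction I rule: infinite_finite_induct)
  case (insert i I)
  have "x i \<in> sections atlas A" "sum x I \<in> sections atlas A"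
    using insert.prems by (auto intro: subspace_sum[OF subspace_sections])
  moreover have "\<rho> (sum x I) u = (\<Sum>i\<in>I. \<rho> (x i) u)"
    using insert by blast
  ultimately show ?case
    by (simp only: sum.insert[OF insert.hyps] rep_add_left[OF _ _ assms(1)])
qed (simp_all add: rep_zero_left assms(1))

section \<open>Images of cochains are derivations\<close>

lemma Phi_snoc:
  assumes "us \<in> tuples (sections atlas E) k" "u \<in> sections atlas E"
  shows "Phi atlas E \<rho> k P (us @ [u]) = \<rho> (P us) u"
  using assms by (auto simp: Phi_def tuples_def)

text \<open>In the first k slots, linearity over smooth functions comes from \<open>P\<close>
  together with \<rho> in its first argument; in the last slot the Leibniz rule of \<rho> supplies
  the symbol. Alternation is inherited from \<open>P\<close> since \<rho>(0) = 0.\<close>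

lemma Phi_in_ders:
  assumes P: "P \<in> cochains atlas E A k"
  shows "Phi atlas E \<rho> k P \<in> ders atlas E k"
proof -
  let ?S = "sections atlas E" and ?D = "Phi atlas E \<rho> k P"
  note closed = cochain_closed[OF P]
  have ml: "?D (us[i := u + v]) = ?D (us[i := u]) + ?D (us[i := v]) \<and>
        ?D (us[i := c *\<^sub>R u]) = c *\<^sub>R ?D (us[i := u])"
    if us: "us \<in> tuples ?S (k + 1)" and i: "i < k + 1" and uv: "u \<in> ?S" "v \<in> ?S" for us i u v c
  proof -
    obtain ws w where w: "us = ws @ [w]" "ws \<in> tuples ?S k" "w \<in> ?S"
      using us by (auto simp: tuples_Suc_iff)
    have uv': "u + v \<in> ?S" "c *\<^sub>R u \<in> ?S"
      using uv E.subspace_sections by (auto intro: subspace_add subspace_scale)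
    show ?thesis
    \<comment> \<open>Slots below k belong to \<open>P\<close>; the remaining slot i = k holds the
      section on which the operator \<rho>(P ws) acts.\<close>
    proof (cases "i < k")
      case True
      then have upd: "(ws @ [w])[i := x] = ws[i := x] @ [w]" for x
        using w by (simp add: list_update_append tuples_def)
      have "P (ws[i := u + v]) = P (ws[i := u]) + P (ws[i := v])"
        "P (ws[i := c *\<^sub>R u]) = c *\<^sub>R P (ws[i := u])"
        using cochain_multilinear[OF P] w uv True by (auto simp: multilinear_on_def)
      then show ?thesis
        using w uv uv' closed
        by (simp add: upd Phi_snoc tuples_update rep_add_left rep_scale_left)
    next
      case False
      then have upd: "(ws @ [w])[i := x] = ws @ [x]" for x
        using w i by (simp add: list_update_append tuples_def)
      then show ?thesis
        using w uv uv' closed by (simp add: upd Phi_snoc rep_add rep_scale)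
    qed
  qed
  \<comment> \<open>A symbol must be a family of maps between fibres, so the anchor is composed with
    \<open>p\<close> and not with the operator \<open>P\<close>.\<close>
  obtain p where p: "p \<in> hom_sections atlas E A k"
    "\<forall>us\<in>tuples ?S k. P us = (\<lambda>x. p x (map (\<lambda>u. u x) us))"
    using cochain_rep[OF P] by blast
  have "\<exists>symb\<in>hom_sections atlas E (tangent_bundle atlas) k.
      \<forall>us\<in>tuples ?S k. \<forall>u\<in>?S. \<forall>f\<in>smooth_functions atlas. ?D (us @ [f \<cdot> u]) =
        f \<cdot> ?D (us @ [u]) + (\<lambda>x. tangent_act atlas x (symb x (map (\<lambda>w. w x) us)) f) \<cdot> u"
    using closed
    by (intro bexI[OF _ hom_sections_anchor[OF p(1)]])
      (auto simp: Phi_snoc E.sections_fun_mult rep_leibniz p(2))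
  moreover have "?D us \<in> ?S" if "us \<in> tuples ?S (k + 1)" for us
    using that closed by (auto simp: tuples_Suc_iff Phi_snoc rep_closed)
  moreover have "?D us = 0" if "us \<notin> tuples ?S (k + 1)" for us
    using that by (simp add: Phi_def)
  moreover have "multilinear_on ?S (k + 1) ?D"
    using ml unfolding multilinear_on_def by blast
  moreover have "alternating_on ?S k (k + 1) ?D"
    unfolding alternating_on_def
  proof (intro ballI allI impI, elim conjE)
    fix us i j assume us: "us \<in> tuples ?S (k + 1)" and ij: "i < j" "j < k" "us ! i = us ! j"
    then obtain ws w where w: "us = ws @ [w]" "ws \<in> tuples ?S k" "w \<in> ?S"
      by (auto simp: tuples_Suc_iff)
    then have "ws ! i = ws ! j"
      using ij by (simp add: nth_append tuples_def)
    then have "P ws = 0"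
      using cochain_alternating[OF P] w ij unfolding alternating_on_def by blast
    then show "?D us = 0"
      using w by (simp add: Phi_snoc rep_zero_left)
  qed
  moreover have "?D (us[i := f \<cdot> u]) = f \<cdot> ?D (us[i := u])"
    if us: "us \<in> tuples ?S (k + 1)" and i: "i < k" and u: "u \<in> ?S" and f: "f \<in> smooth_functions atlas"
    for us i u f
  proof -
    obtain ws w where w: "us = ws @ [w]" "ws \<in> tuples ?S k" "w \<in> ?S"
      using us by (auto simp: tuples_Suc_iff)
    then have upd: "(ws @ [w])[i := x] = ws[i := x] @ [w]" for x
      using i by (simp add: list_update_append tuples_def)
    show ?thesis
      using w i u f closed E.sections_fun_mult[OF f u] cochain_fun_mult[OF P w(2) i u f]
      by (simp add: upd Phi_snoc tuples_update rep_fun_left)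
  qed
  ultimately show ?thesis
    unfolding ders_def by blast
qed

end

section \<open>Compatibility with the brackets\<close>

context lie_rep_pair
begin

text \<open>The two insertion terms of the bracket are this sum and the one with P and Q exchanged.
  For n = 0 the last block has length -1 and the sum is empty.\<close>

definition insertion_sum ::
  "nat \<Rightarrow> nat \<Rightarrow> (('m \<Rightarrow> 'e) list \<Rightarrow> ('m \<Rightarrow> 'a)) \<Rightarrow> (('m \<Rightarrow> 'e) list \<Rightarrow> ('m \<Rightarrow> 'a)) \<Rightarrow>
   ('m \<Rightarrow> 'e) list \<Rightarrow> ('m \<Rightarrow> 'a)" where
  "insertion_sum n m P Q us = (\<Sum>\<sigma>\<in>unshuffles [int m, 1, int n - 1]. sgn_perm \<sigma> *\<^sub>R
     P (\<rho> (Q (subargs us \<sigma> 0 m)) (us ! \<sigma> m) # subargs us \<sigma> (m + 1) (m + n)))"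

text \<open>The existence of such an unshuffle forces \<open>int n - 1\<close> to be nonnegative, so
  n > 0. The inserted section and the n - 1 remaining ones then make up the n arguments of
  P.\<close>

lemma insertion_arg:
  assumes "Q \<in> cochains atlas E A m" "ws \<in> tuples (sections atlas E) (m + n)"
    and \<sigma>: "\<sigma> \<in> unshuffles [int m, 1, int n - 1]"
  shows "\<rho> (Q (subargs ws \<sigma> 0 m)) (ws ! \<sigma> m) # subargs ws \<sigma> (m + 1) (m + n) \<in> tuples (sections atlas E) n"
    and "\<sigma> permutes {..<m + n}" "0 < n"
proof -
  show n: "0 < n"
    using \<sigma> unshuffles_neg[of "int n - 1" "[int m, 1, int n - 1]"] by (cases n) auto
  have "nat (sum_list [int m, 1, int n - 1]) = m + n" by simp
  then show p: "\<sigma> permutes {..<m + n}"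
    using unshuffles_permutes[OF \<sigma>] by simp
  have "\<rho> (Q (subargs ws \<sigma> 0 m)) (ws ! \<sigma> m) \<in> sections atlas E"
    using subargs_tuples[OF assms(2) p, of m 0] n
    by (intro rep_closed cochain_closed[OF assms(1)] nth_permutes_tuples[OF assms(2) p]) auto
  moreover have "subargs ws \<sigma> (m + 1) (m + n) \<in> tuples (sections atlas E) (n - 1)"
    using subargs_tuples[OF assms(2) p, of "m + n" "m + 1"] by simp
  ultimately show "\<rho> (Q (subargs ws \<sigma> 0 m)) (ws ! \<sigma> m) # subargs ws \<sigma> (m + 1) (m + n) \<in> tuples (sections atlas E) n"
    using n by (auto simp: tuples_def)
qed

lemma insertion_sum_closed:
  assumes "P \<in> cochains atlas E A n" "Q \<in> cochains atlas E A m" "ws \<in> tuples (sections atlas E) (m + n)"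
  shows "insertion_sum n m P Q ws \<in> sections atlas A"
  unfolding insertion_sum_def
  by (intro subspace_sum subspace_scale subspace_sections cochain_closed[OF assms(1)]
      insertion_arg[OF assms(2,3)])

lemma rep_insertion_sum:
  assumes "P \<in> cochains atlas E A n" "Q \<in> cochains atlas E A m"
    and "ws \<in> tuples (sections atlas E) (m + n)" "w \<in> sections atlas E"
  shows "\<rho> (insertion_sum n m P Q ws) w = (\<Sum>\<sigma>\<in>unshuffles [int m, 1, int n - 1]. sgn_perm \<sigma> *\<^sub>R
     \<rho> (P (\<rho> (Q (subargs ws \<sigma> 0 m)) (ws ! \<sigma> m) # subargs ws \<sigma> (m + 1) (m + n))) w)"
proof -
  let ?x = "\<lambda>\<sigma>. P (\<rho> (Q (subargs ws \<sigma> 0 m)) (ws ! \<sigma> m) # subargs ws \<sigma> (m + 1) (m + n))"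
  have x: "?x \<sigma> \<in> sections atlas A" if "\<sigma> \<in> unshuffles [int m, 1, int n - 1]" for \<sigma>
    using cochain_closed[OF assms(1) insertion_arg(1)[OF assms(2,3) that]] .
  have "\<rho> (insertion_sum n m P Q ws) w =
      (\<Sum>\<sigma>\<in>unshuffles [int m, 1, int n - 1]. \<rho> (sgn_perm \<sigma> *\<^sub>R ?x \<sigma>) w)"
    unfolding insertion_sum_def
    by (intro rep_sum_left assms subspace_scale subspace_sections x)
  also have "\<dots> = (\<Sum>\<sigma>\<in>unshuffles [int m, 1, int n - 1]. sgn_perm \<sigma> *\<^sub>R \<rho> (?x \<sigma>) w)"
    by (intro sum.cong refl rep_scale_left x assms)
  finally show ?thesis .
qed

text \<open>In the first sum the last argument of the inner derivation is the section on which
  \<rho>(Q) acts, so its value is exactly the section inserted into P. In the second sum both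
  operators act on \<open>w\<close> in succession.\<close>

lemma der_comp_Phi:
  assumes "P \<in> cochains atlas E A n" "Q \<in> cochains atlas E A m"
    and "ws \<in> tuples (sections atlas E) (m + n)" "w \<in> sections atlas E"
  shows "der_comp atlas E n m (Phi atlas E \<rho> n P) (Phi atlas E \<rho> m Q) (ws @ [w]) =
    \<rho> (insertion_sum n m P Q ws) w + (-1) ^ (m * n) *\<^sub>R
      product_sum n m (\<lambda>xs ys. \<rho> (P xs) (\<rho> (Q ys) w)) ws"
proof -
  let ?D1 = "Phi atlas E \<rho> n P" and ?D2 = "Phi atlas E \<rho> m Q" and ?us = "ws @ [w]"
  have len: "length ws = m + n" using tuples_length[OF assms(3)] .
  have us: "?us \<in> tuples (sections atlas E) (m + n + 1)"
    using assms(3,4) by (auto simp: tuples_Suc_iff)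
  have "?D1 (?D2 (subargs ?us \<sigma> 0 (m + 1)) # subargs ?us \<sigma> (m + 1) (m + n) @ [?us ! (m + n)])
      = \<rho> (P (\<rho> (Q (subargs ws \<sigma> 0 m)) (ws ! \<sigma> m) # subargs ws \<sigma> (m + 1) (m + n))) w"
    if "\<sigma> \<in> unshuffles [int m, 1, int n - 1]" for \<sigma>
  proof -
    note i = insertion_arg[OF assms(2,3) that]
    \<comment> \<open>The bound m + 1 \<le> m + n, which keeps these indices within
      \<open>ws\<close>, comes from n > 0.\<close>
    have "subargs ?us \<sigma> 0 (m + 1) = subargs ws \<sigma> 0 (m + 1)"
      using i(2,3) len by (intro subargs_append) simp_all
    then have "subargs ?us \<sigma> 0 (m + 1) = subargs ws \<sigma> 0 m @ [ws ! \<sigma> m]"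
      by (simp only: subargs_def) simp
    moreover have "subargs ?us \<sigma> (m + 1) (m + n) = subargs ws \<sigma> (m + 1) (m + n)"
      using subargs_append[of \<sigma> ws "m + n"] i(2) len by simp
    moreover have "subargs ws \<sigma> 0 m \<in> tuples (sections atlas E) m" "ws ! \<sigma> m \<in> sections atlas E"
      using subargs_tuples[OF assms(3) i(2), of m 0] nth_permutes_tuples[OF assms(3) i(2)] i(3) by auto
    ultimately show ?thesis
      using Phi_snoc[OF i(1) assms(4), of P] Phi_snoc[of "subargs ws \<sigma> 0 m" m "ws ! \<sigma> m" Q] len
      by (simp add: nth_append)
  qed
  moreover have "?D1 (subargs ?us \<sigma> 0 n @ [?D2 (subargs ?us \<sigma> n (m + n) @ [?us ! (m + n)])])
      = \<rho> (P (subargs ws \<sigma> 0 n)) (\<rho> (Q (subargs ws \<sigma> n (m + n))) w)"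
    if "\<sigma> \<in> unshuffles [int n, int m]" for \<sigma>
  proof -
    have p: "\<sigma> permutes {..<m + n}"
      using that by (simp add: unshuffles_two_iff add.commute)
    then have "subargs ?us \<sigma> 0 n = subargs ws \<sigma> 0 n" "subargs ?us \<sigma> n (m + n) = subargs ws \<sigma> n (m + n)"
      using len by (simp_all add: subargs_append)
    moreover have xs: "subargs ws \<sigma> 0 n \<in> tuples (sections atlas E) n"
      and ys: "subargs ws \<sigma> n (m + n) \<in> tuples (sections atlas E) m"
      using subargs_tuples[OF assms(3) p, of n 0] subargs_tuples[OF assms(3) p, of "m + n" n] by simp_all
    moreover have "\<rho> (Q (subargs ws \<sigma> n (m + n))) w \<in> sections atlas E"
      using rep_closed[OF cochain_closed[OF assms(2) ys] assms(4)] .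
    ultimately show ?thesis
      using len by (simp add: Phi_snoc[OF ys assms(4)] Phi_snoc[OF xs] nth_append)
  qed
  ultimately show ?thesis
    using us unfolding der_comp_def rep_insertion_sum[OF assms] product_sum_def
    by (simp cong: sum.cong)
qed

section \<open>Product terms of the bracket\<close>

lemma product_args:
  assumes "P \<in> cochains atlas E A n" "Q \<in> cochains atlas E A m" "ws \<in> tuples (sections atlas E) (m + n)"
    and "\<sigma> \<in> unshuffles [int n, int m]"
  shows "P (subargs ws \<sigma> 0 n) \<in> sections atlas A" "Q (subargs ws \<sigma> n (m + n)) \<in> sections atlas A"
proof -
  have p: "\<sigma> permutes {..<m + n}"
    using assms(4) by (simp add: unshuffles_two_iff add.commute)
  show "P (subargs ws \<sigma> 0 n) \<in> sections atlas A" "Q (subargs ws \<sigma> n (m + n)) \<in> sections atlas A"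
    using subargs_tuples[OF assms(3) p, of n 0] subargs_tuples[OF assms(3) p, of "m + n" n]
    by (auto intro: cochain_closed[OF assms(1)] cochain_closed[OF assms(2)])
qed

lemma product_sum_brk_closed:
  assumes "P \<in> cochains atlas E A n" "Q \<in> cochains atlas E A m" "ws \<in> tuples (sections atlas E) (m + n)"
  shows "product_sum n m (\<lambda>xs ys. brk (P xs) (Q ys)) ws \<in> sections atlas A"
  unfolding product_sum_def
  by (intro subspace_sum subspace_scale subspace_sections brk_closed product_args[OF assms])

text \<open>Linearity moves \<rho> inside the sum, where \<open>rep_bracket\<close> turns each
  bracket into a commutator.\<close>

lemma rep_product_sum_brk:
  assumes "P \<in> cochains atlas E A n" "Q \<in> cochains atlas E A m"
    and "ws \<in> tuples (sections atlas E) (m + n)" "w \<in> sections atlas E"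
  shows "\<rho> (product_sum n m (\<lambda>xs ys. brk (P xs) (Q ys)) ws) w =
    product_sum n m (\<lambda>xs ys. \<rho> (P xs) (\<rho> (Q ys) w)) ws -
    product_sum n m (\<lambda>xs ys. \<rho> (Q ys) (\<rho> (P xs) w)) ws"
proof -
  let ?P = "\<lambda>\<sigma>. P (subargs ws \<sigma> 0 n)" and ?Q = "\<lambda>\<sigma>. Q (subargs ws \<sigma> n (m + n))"
  note closed = product_args[OF assms(1-3)]
  have "\<rho> (product_sum n m (\<lambda>xs ys. brk (P xs) (Q ys)) ws) w =
      (\<Sum>\<sigma>\<in>unshuffles [int n, int m]. \<rho> (sgn_perm \<sigma> *\<^sub>R brk (?P \<sigma>) (?Q \<sigma>)) w)"
    unfolding product_sum_def
    by (intro rep_sum_left assms subspace_scale subspace_sections brk_closed closed)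
  also have "\<dots> = (\<Sum>\<sigma>\<in>unshuffles [int n, int m].
      sgn_perm \<sigma> *\<^sub>R (\<rho> (?P \<sigma>) (\<rho> (?Q \<sigma>) w) - \<rho> (?Q \<sigma>) (\<rho> (?P \<sigma>) w)))"
    by (intro sum.cong refl) (simp only: rep_scale_left[OF brk_closed] rep_bracket closed assms(4))
  finally show ?thesis
    unfolding product_sum_def scaleR_diff_right sum_subtractf .
qed

lemma cochain_bracket_eq:
  assumes "ws \<in> tuples (sections atlas E) (m + n)"
  shows "cochain_bracket atlas E brk \<rho> n m P Q ws =
    insertion_sum n m P Q ws - (-1) ^ (m * n) *\<^sub>R insertion_sum m n Q P ws
    + (-1) ^ (m * n) *\<^sub>R product_sum n m (\<lambda>xs ys. brk (P xs) (Q ys)) ws"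
  using assms
  by (simp only: cochain_bracket_def insertion_sum_def product_sum_def if_True add.commute[of n m])

lemma cochain_bracket_closed:
  assumes P: "P \<in> cochains atlas E A n" and Q: "Q \<in> cochains atlas E A m"
    and ws: "ws \<in> tuples (sections atlas E) (m + n)"
  shows "cochain_bracket atlas E brk \<rho> n m P Q ws \<in> sections atlas A"
proof -
  have ws': "ws \<in> tuples (sections atlas E) (n + m)"
    using ws by (simp only: add.commute)
  show ?thesis
    unfolding cochain_bracket_eq[OF ws]
    by (intro subspace_add subspace_diff subspace_scale subspace_sections product_sum_brk_closed
        insertion_sum_closed P Q ws ws')
qed

text \<open>On \<open>ws @ [w]\<close> the insertion sums agree on both sides. The composites
  \<rho>(Q)\<rho>(P) arise over (m,n)-unshuffles, and the exchange of blocks makes them the second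
  halves of the commutators. On lists outside the domain both sides are 0.\<close>

lemma Phi_cochain_bracket:
  assumes P: "P \<in> cochains atlas E A n" and Q: "Q \<in> cochains atlas E A m"
  shows "Phi atlas E \<rho> (n + m) (cochain_bracket atlas E brk \<rho> n m P Q) =
    mn_bracket atlas E n m (Phi atlas E \<rho> n P) (Phi atlas E \<rho> m Q)"
proof
  fix us
  show "Phi atlas E \<rho> (n + m) (cochain_bracket atlas E brk \<rho> n m P Q) us =
    mn_bracket atlas E n m (Phi atlas E \<rho> n P) (Phi atlas E \<rho> m Q) us"
  proof (cases "us \<in> tuples (sections atlas E) (m + n + 1)")
    case False
    then have "us \<notin> tuples (sections atlas E) (n + m + 1)"
      by (simp add: add.commute)
    with False show ?thesis
      by (simp add: Phi_def mn_bracket_def der_comp_def scaleR_fun_def zero_fun_def)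
  next
    case True
    then obtain ws w where us: "us = ws @ [w]" and ws: "ws \<in> tuples (sections atlas E) (m + n)"
      and w: "w \<in> sections atlas E"
      by (auto simp: tuples_Suc_iff)
    have ws': "ws \<in> tuples (sections atlas E) (n + m)"
      using ws by (simp only: add.commute)
    let ?e = "(-1) ^ (m * n) :: real"
    let ?I = "\<rho> (insertion_sum n m P Q ws) w" and ?J = "\<rho> (insertion_sum m n Q P ws) w"
    let ?X = "product_sum n m (\<lambda>xs ys. \<rho> (P xs) (\<rho> (Q ys) w)) ws"
      and ?Y = "product_sum n m (\<lambda>xs ys. \<rho> (Q ys) (\<rho> (P xs) w)) ws"
    note closed = insertion_sum_closed[OF P Q ws] insertion_sum_closed[OF Q P ws']
      product_sum_brk_closed[OF P Q ws]
    have "\<rho> (cochain_bracket atlas E brk \<rho> n m P Q ws) w = ?I - ?e *\<^sub>R ?J + ?e *\<^sub>R (?X - ?Y)"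
      unfolding cochain_bracket_eq[OF ws] rep_product_sum_brk[OF P Q ws w, symmetric]
      by (simp only: rep_add_left rep_diff_left rep_scale_left closed w subspace_scale subspace_diff
          subspace_sections)
    \<comment> \<open>Since the square of \<open>?e\<close> is 1, two extra factors may be inserted
      before \<open>?Y\<close>. The innermost one produces the sum over (m,n)-unshuffles, the middle
      one is the sign inside the composition of \<Phi>(Q) with \<Phi>(P).\<close>
    also have "\<dots> = (?I + ?e *\<^sub>R ?X) - ?e *\<^sub>R (?J + ?e *\<^sub>R (?e *\<^sub>R ?Y))"
      by (simp add: algebra_simps flip: power_add)
    also have "\<dots> = mn_bracket atlas E n m (Phi atlas E \<rho> n P) (Phi atlas E \<rho> m Q) us"
      unfolding us mn_bracket_def fun_diff_def scaleR_fun_def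
        der_comp_Phi[OF P Q ws w] der_comp_Phi[OF Q P ws' w]
        product_sum_swap[of m n "\<lambda>ys xs. \<rho> (Q ys) (\<rho> (P xs) w)"] mult.commute[of n m] ..
    finally show ?thesis
      unfolding us Phi_snoc[OF ws' w] .
  qed
qed

section \<open>Linearity of \<Phi> and passage to the direct sums\<close>

lemma Phi_add:
  assumes "\<And>us. us \<in> tuples (sections atlas E) k \<Longrightarrow> P us \<in> sections atlas A"
    and "\<And>us. us \<in> tuples (sections atlas E) k \<Longrightarrow> Q us \<in> sections atlas A"
  shows "Phi atlas E \<rho> k (P + Q) = Phi atlas E \<rho> k P + Phi atlas E \<rho> k Q"
proof
  fix us
  show "Phi atlas E \<rho> k (P + Q) us = (Phi atlas E \<rho> k P + Phi atlas E \<rho> k Q) us"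
  proof (cases "us \<in> tuples (sections atlas E) (k + 1)")
    case True
    then obtain ws w where us: "us = ws @ [w]" and ws: "ws \<in> tuples (sections atlas E) k"
      and w: "w \<in> sections atlas E"
      by (auto simp: tuples_Suc_iff)
    show ?thesis
      unfolding us plus_fun_apply[of "Phi atlas E \<rho> k P"] Phi_snoc[OF ws w] plus_fun_apply[of P Q]
      by (rule rep_add_left[OF assms[OF ws] w])
  qed (simp add: Phi_def)
qed

lemma Phi_scale:
  assumes "P \<in> cochains atlas E A k"
  shows "Phi atlas E \<rho> k (c *\<^sub>R P) = c *\<^sub>R Phi atlas E \<rho> k P"
proof
  fix us
  show "Phi atlas E \<rho> k (c *\<^sub>R P) us = (c *\<^sub>R Phi atlas E \<rho> k P) us"
  proof (cases "us \<in> tuples (sections atlas E) (k + 1)")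
    case True
    then obtain ws w where us: "us = ws @ [w]" and ws: "ws \<in> tuples (sections atlas E) k"
      and w: "w \<in> sections atlas E"
      by (auto simp: tuples_Suc_iff)
    show ?thesis
      unfolding us scaleR_fun_def[of c "Phi atlas E \<rho> k P"] scaleR_fun_def[of c P] Phi_snoc[OF ws w]
      by (rule rep_scale_left[OF cochain_closed[OF assms ws] w])
  qed (simp add: Phi_def scaleR_fun_def zero_fun_def)
qed

lemma Phi_zero: "Phi atlas E \<rho> k 0 = 0"
proof
  show "Phi atlas E \<rho> k 0 us = 0 us" for us
    by (auto simp: Phi_def tuples_Suc_iff nth_append rep_zero_left dest: tuples_length)
qed

text \<open>The hypothesis asks for values in \<Gamma>(A), which is what
  \<open>cochain_bracket_closed\<close> provides for the summands of a total bracket.\<close>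

lemma Phi_sum:
  assumes "\<And>i us. i \<in> I \<Longrightarrow> us \<in> tuples (sections atlas E) k \<Longrightarrow> P i us \<in> sections atlas A"
  shows "Phi atlas E \<rho> k (\<Sum>i\<in>I. P i) = (\<Sum>i\<in>I. Phi atlas E \<rho> k (P i))"
  using assms
proof (induction I rule: infinite_finite_induct)
  case (insert i I)
  have "P i us \<in> sections atlas A" "(\<Sum>i\<in>I. P i) us \<in> sections atlas A" if "us \<in> tuples (sections atlas E) k" for us
    unfolding sum_fun_apply[of P I us] using insert.prems that
    by (auto intro: subspace_sum[OF subspace_sections])
  then have "Phi atlas E \<rho> k (P i + (\<Sum>i\<in>I. P i)) =
      Phi atlas E \<rho> k (P i) + Phi atlas E \<rho> k (\<Sum>i\<in>I. P i)"
    by (rule Phi_add)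
  moreover have "Phi atlas E \<rho> k (\<Sum>i\<in>I. P i) = (\<Sum>i\<in>I. Phi atlas E \<rho> k (P i))"
    using insert by blast
  ultimately show ?case
    by (simp only: sum.insert[OF insert.hyps])
qed (simp_all add: Phi_zero)

lemma Phi_total_bracket:
  assumes "F \<in> direct_sum (cochains atlas E A)" "G \<in> direct_sum (cochains atlas E A)"
  shows "Phi atlas E \<rho> k (total_bracket (cochain_bracket atlas E brk \<rho>) F G k) =
    total_bracket (mn_bracket atlas E) (\<lambda>k. Phi atlas E \<rho> k (F k)) (\<lambda>k. Phi atlas E \<rho> k (G k)) k"
proof -
  have FG: "F n \<in> cochains atlas E A n" "G n \<in> cochains atlas E A n" for n
    using assms by (auto simp: direct_sum_def)
  let ?b = "\<lambda>n. cochain_bracket atlas E brk \<rho> n (k - n) (F n) (G (k - n))"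
  have "Phi atlas E \<rho> k (\<Sum>n\<le>k. ?b n) = (\<Sum>n\<le>k. Phi atlas E \<rho> k (?b n))"
    by (rule Phi_sum) (use FG in \<open>auto intro!: cochain_bracket_closed\<close>)
  also have "\<dots> = (\<Sum>n\<le>k. mn_bracket atlas E n (k - n) (Phi atlas E \<rho> n (F n)) (Phi atlas E \<rho> (k - n) (G (k - n))))"
  proof (rule sum.cong[OF refl])
    fix n assume "n \<in> {..k}"
    \<comment> \<open>The subtraction is not truncated for n \<le> k, so every summand has degree
      k.\<close>
    then have "n + (k - n) = k" by simp
    then show "Phi atlas E \<rho> k (?b n) =
        mn_bracket atlas E n (k - n) (Phi atlas E \<rho> n (F n)) (Phi atlas E \<rho> (k - n) (G (k - n)))"
      using Phi_cochain_bracket[OF FG(1)[of n] FG(2)[of "k - n"]] by simp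
  qed
  finally show ?thesis
    by (simp add: total_bracket_def)
qed

end

theorem theorem5p12:
  fixes atlas :: "('m::{t2_space, second_countable_topology}, 'b::fin_dim) chart set"
    and A :: "('m, 'a::real_vector, 'g::fin_dim) vbundle"
    and brk :: "('m \<Rightarrow> 'a) \<Rightarrow> ('m \<Rightarrow> 'a) \<Rightarrow> ('m \<Rightarrow> 'a)"
    and anchor :: "'m \<Rightarrow> 'a \<Rightarrow> (('m, 'b) chart \<Rightarrow> 'b)"
    and E :: "('m, 'e::real_vector, 'f::fin_dim) vbundle"
    and \<rho> :: "('m \<Rightarrow> 'a) \<Rightarrow> ('m \<Rightarrow> 'e) \<Rightarrow> ('m \<Rightarrow> 'e)"
  assumes "lie_rep_pair atlas A brk anchor E \<rho>"
  shows "graded_lie_hom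
    (cochains atlas E A) (cochain_bracket atlas E brk \<rho>)
    (ders atlas E) (mn_bracket atlas E)
    (\<lambda>P k. Phi atlas E \<rho> k (P k))"
proof -
  interpret lie_rep_pair atlas A brk anchor E \<rho> by (rule assms)
  have coch: "F k \<in> cochains atlas E A k" if "F \<in> direct_sum (cochains atlas E A)" for F k
    using that by (simp add: direct_sum_def)
  show ?thesis
    unfolding graded_lie_hom_def
  proof (intro conjI ballI allI impI)
    show "(\<lambda>k. Phi atlas E \<rho> k (F k)) \<in> direct_sum (ders atlas E)"
      if F: "F \<in> direct_sum (cochains atlas E A)" for F
    proof -
      \<comment> \<open>Since \<Phi> maps 0 to 0 in every degree, the support can only shrink and
        stays finite.\<close>
      have "{k. Phi atlas E \<rho> k (F k) \<noteq> 0} \<subseteq> {k. F k \<noteq> 0}"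
        using Phi_zero by force
      then show ?thesis
        using F Phi_in_ders by (auto simp: direct_sum_def intro: finite_subset)
    qed
    show "(\<lambda>k. Phi atlas E \<rho> k ((F + G) k)) = (\<lambda>k. Phi atlas E \<rho> k (F k)) + (\<lambda>k. Phi atlas E \<rho> k (G k))"
      if "F \<in> direct_sum (cochains atlas E A)" "G \<in> direct_sum (cochains atlas E A)" for F G
      unfolding plus_fun_def[of "\<lambda>k. Phi atlas E \<rho> k (F k)"] plus_fun_apply[of F G]
      by (rule ext, rule Phi_add, erule cochain_closed[OF coch[OF that(1)]],
          erule cochain_closed[OF coch[OF that(2)]])
    show "(\<lambda>k. Phi atlas E \<rho> k ((c *\<^sub>R F) k)) = c *\<^sub>R (\<lambda>k. Phi atlas E \<rho> k (F k))"
      if "F \<in> direct_sum (cochains atlas E A)" for F c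
      unfolding scaleR_fun_def[of c F] scaleR_fun_def[of c "\<lambda>k. Phi atlas E \<rho> k (F k)"]
      by (rule ext, rule Phi_scale[OF coch[OF that]])
    show "(\<lambda>k. Phi atlas E \<rho> k (total_bracket (cochain_bracket atlas E brk \<rho>) F G k)) =
        total_bracket (mn_bracket atlas E) (\<lambda>k. Phi atlas E \<rho> k (F k)) (\<lambda>k. Phi atlas E \<rho> k (G k))"
      if "F \<in> direct_sum (cochains atlas E A)" "G \<in> direct_sum (cochains atlas E A)" for F G
      by (rule ext) (rule Phi_total_bracket[OF that])
    show "Phi atlas E \<rho> j (F j) = 0"
      if "\<forall>j. j \<noteq> k \<longrightarrow> F j = 0" "j \<noteq> k" for F j k
      using that Phi_zero by simp
  qed
qed

end
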